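(* Let $\mathcal{M}$ be a bipartite regular matroid on the ground set $E$. For any $e \in E$, \[ h^*(\Sigma(\mathcal{M});t) = (1+t)\,h^*(\Sigma(\mathcal{M} / e); t). \]
   Context: A matroid $\mathcal{M}$ is regular if it is representable over every field; equivalently, it is isomorphic to the vector matroid (over $\mathbb{R}$) of a totally unimodular matrix $A$ (every minor is $0$ or $\pm1$). The generalized symmetric edge polytope is $\Sigma(\mathcal{M}) = \operatorname{conv}\{\pm u \mid u \text{ is a column of } A\}$; it is well defined up to unimodular equivalence. If $\mathcal{M}$ has rank $0$ (including the empty matroid), $\Sigma(\mathcal{M})$ is understood to be the single point $\{0\}$, with $h^*$-polynomial $1$. A matroid is bipartite if each of its circuits has even size. For a non-loop $e$, the contraction $\mathcal{M}/e$ is the matroid on $E - e$ with independent sets $\{I - e \mid e \in I,\ I \text{ independent in } \mathcal{M}\}$ (a bipartite matroid has no loops). For a lattice polytope $P \subset \mathbb{R}^n$, let $L_P(m) = |mP \cap \mathbb{Z}^n|$ for $m\ge1$ and $L_P(0)=1$; the $h^*$-polynomial $h^*(P;t)$ is defined by $\sum_{m \ge 0} L_P(m) t^m = h^*(P;t)/(1-t)^{\dim P + 1}$. *)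

theory Defs
  imports
    "HOL-Analysis.Analysis"
    "HOL-Computational_Algebra.Formal_Power_Series"
    "Jordan_Normal_Form.Determinant"
begin

locale matroid =
  fixes E :: "'a set" and indep :: "'a set \<Rightarrow> bool"
  assumes finite_ground: "finite E"
    and indep_subset_ground: "indep X \<Longrightarrow> X \<subseteq> E"
    and indep_empty: "indep {}"
    and indep_subset: "indep X \<Longrightarrow> Y \<subseteq> X \<Longrightarrow> indep Y"
    and indep_augment:
      "indep X \<Longrightarrow> indep Y \<Longrightarrow> card X < card Y \<Longrightarrow> \<exists>y\<in>Y - X. indep (insert y X)"

definition circuit :: "'a set \<Rightarrow> ('a set \<Rightarrow> bool) \<Rightarrow> 'a set \<Rightarrow> bool" where
  "circuit E indep C \<longleftrightarrow> C \<subseteq> E \<and> \<not> indep C \<and> (\<forall>D. D \<subset> C \<longrightarrow> indep D)"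

definition bipartite_matroid :: "'a set \<Rightarrow> ('a set \<Rightarrow> bool) \<Rightarrow> bool" where
  "bipartite_matroid E indep \<longleftrightarrow> (\<forall>C. circuit E indep C \<longrightarrow> even (card C))"

text \<open>Independent sets of the contraction by \<open>e\<close>; its ground set is \<open>E - {e}\<close>.
  This is the contraction only if \<open>e\<close> is not a loop.\<close>

definition contract_indep :: "('a set \<Rightarrow> bool) \<Rightarrow> 'a \<Rightarrow> 'a set \<Rightarrow> bool" where
  "contract_indep indep e X \<longleftrightarrow> (\<exists>I. e \<in> I \<and> indep I \<and> X = I - {e})"

text \<open>A real matrix with row index type \<open>'m\<close> and columns labelled by the set \<open>E\<close> is given as
  the family \<open>A\<close> of its columns, restricted to \<open>E\<close>. The injections \<open>r\<close> and \<open>c\<close>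
  choose the rows and columns of a square submatrix.\<close>

definition totally_unimodular :: "'a set \<Rightarrow> ('a \<Rightarrow> real ^ 'm) \<Rightarrow> bool" where
  "totally_unimodular E A \<longleftrightarrow>
    (\<forall>k (r :: nat \<Rightarrow> 'm) c.
      inj_on r {..<k} \<and> inj_on c {..<k} \<and> c ` {..<k} \<subseteq> E \<longrightarrow>
      Determinant.det (Matrix.mat k k (\<lambda>(i, j). vec_nth (A (c j)) (r i))) \<in> {-1, 0, 1})"

text \<open>The vector matroid of \<open>A\<close> is a matroid on the column labels, so repeated
  columns are parallel elements; hence the injectivity condition.\<close>

definition vector_matroid_indep :: "'a set \<Rightarrow> ('a \<Rightarrow> real ^ 'm) \<Rightarrow> 'a set \<Rightarrow> bool" where
  "vector_matroid_indep E A X \<longleftrightarrow> X \<subseteq> E \<and> inj_on A X \<and> independent (A ` X)"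

text \<open>A matroid is regular iff it has such a representation for some number of rows. The
  isomorphism with the vector matroid is the labelling of the columns by \<open>E\<close>.\<close>

definition regular_representation ::
    "'a set \<Rightarrow> ('a set \<Rightarrow> bool) \<Rightarrow> ('a \<Rightarrow> real ^ 'm) \<Rightarrow> bool" where
  "regular_representation E indep A \<longleftrightarrow>
    totally_unimodular E A \<and> (\<forall>X. indep X \<longleftrightarrow> vector_matroid_indep E A X)"

text \<open>For nonempty \<open>E\<close> of rank \<open>0\<close> all columns vanish and the convex hull is already
  \<open>{0}\<close>, so only the empty matroid needs the convention.\<close>

definition symmetric_edge_polytope :: "'a set \<Rightarrow> ('a \<Rightarrow> real ^ 'm) \<Rightarrow> (real ^ 'm) set" where
  "symmetric_edge_polytope E A =
    (if E = {} then {0} else convex hull (\<Union>u\<in>A ` E. {u, - u}))"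

definition lattice_point_count :: "(real ^ 'n) set \<Rightarrow> nat \<Rightarrow> nat" where
  "lattice_point_count P m =
    (if m = 0 then 1 else card ((\<lambda>x. real m *\<^sub>R x) ` P \<inter> {x. \<forall>i. vec_nth x i \<in> \<int>}))"

definition ehrhart_series :: "(real ^ 'n) set \<Rightarrow> int fps" where
  "ehrhart_series P = Abs_fps (\<lambda>m. int (lattice_point_count P m))"

text \<open>The unique solution \<open>h\<close> of \<open>ehrhart_series P = h / (1 - t) ^ (dim P + 1)\<close>. By
  Ehrhart's theorem it is a polynomial when \<open>P\<close> is a nonempty lattice polytope; taking it as
  a formal power series makes it well defined without appeal to that theorem, and identities
  of polynomials and of their power series are the same.\<close>

definition hstar :: "(real ^ 'n) set \<Rightarrow> int fps" where
  "hstar P = ehrhart_series P * (1 - fps_X) ^ (nat (aff_dim P) + 1)"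

end

theory Submission
  imports Defs
begin

text \<open>By total unimodularity, the lattice points of \<open>m \<Sigma>(M)\<close> are the integer combinations of the columns
  whose coefficients have \<open>l\<^sup>1\<close> norm at most \<open>m\<close>; hence they form the ball of radius \<open>m\<close> in the
  Cayley graph of the lattice \<open>L\<close> generated by the columns. Contracting \<open>e\<close> replaces \<open>L\<close> by
  \<open>L / \<int> A e\<close>. On a coset of \<open>\<int> A e\<close> the word length is convex, and if \<open>M\<close> is bipartite it changes
  parity at every step; so its values are \<open>l + \<bar>k - k\<^sub>0\<bar>\<close>, where \<open>l\<close> is the word length of the coset.
  Each coset thus contributes \<open>t^l (1 + t) / (1 - t)\<close> to the spherical growth series of \<open>L\<close>.
  That the answer does not depend on the representation of \<open>M / e\<close> follows from the uniqueness of
  unimodular representations up to signs.\<close>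

section \<open>Linear combinations of families of vectors\<close>

text \<open>Uniqueness enters only through linear relations: the cardinality of a ball depends only
  on which coefficient families combine to 0, and the matroid determines this kernel up to signs. No
  unimodular map between polytopes is constructed. The obstacle is the consistency of the signs.
  When a column is added by induction, its coordinates in the two representations agree up to signs
  in any basis, but the flips that correct them must also respect all relations among the earlier
  columns. They are therefore made on a separator (a union of connected components), built from
  circuits through an auxiliary vector. Integrality comes from sparsity: a lattice point of a
  dilated polytope can be rewritten on an independent set of columns without raising the l1 norm,
  and there Cramer's rule with a minor \<plusminus>1 forces integer coefficients. The parity used on
  a line is that of the sum of coefficients. Mod 2 it depends only on the lattice point, because the
  relations are generated by those of fundamental circuits, which have even size.\<close>

definition lincomb :: "('a \<Rightarrow> 'v :: real_vector) \<Rightarrow> 'a set \<Rightarrow> ('a \<Rightarrow> real) \<Rightarrow> 'v" where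
  "lincomb u X c = (\<Sum>g\<in>X. c g *\<^sub>R u g)"

text \<open>Independence of the labelled family: two labels with the same column are dependent, as
  parallel elements of a matroid must be. Independence of the image set would not see them.\<close>

definition indep_family :: "('a \<Rightarrow> 'v :: real_vector) \<Rightarrow> 'a set \<Rightarrow> bool" where
  "indep_family u X \<longleftrightarrow> (\<forall>c. lincomb u X c = 0 \<longrightarrow> (\<forall>g\<in>X. c g = 0))"

lemma lincomb_add: "lincomb u X (\<lambda>g. c g + d g) = lincomb u X c + lincomb u X d"
  by (simp add: lincomb_def scaleR_add_left sum.distrib)

lemma lincomb_diff: "lincomb u X (\<lambda>g. c g - d g) = lincomb u X c - lincomb u X d"
  by (simp add: lincomb_def scaleR_diff_left sum_subtractf)

lemma lincomb_scale: "lincomb u X (\<lambda>g. t * c g) = t *\<^sub>R lincomb u X c"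
  by (simp add: lincomb_def scaleR_sum_right)

lemma lincomb_cong: "(\<And>g. g \<in> X \<Longrightarrow> c g = d g) \<Longrightarrow> lincomb u X c = lincomb u X d"
  by (simp add: lincomb_def)

lemma lincomb_mono_neutral:
  assumes "finite Y" "X \<subseteq> Y" "\<And>g. g \<in> Y - X \<Longrightarrow> c g = 0"
  shows "lincomb u Y c = lincomb u X c"
  unfolding lincomb_def by (rule sum.mono_neutral_right) (use assms in auto)

lemma lincomb_extend:
  assumes "finite Y" "X \<subseteq> Y"
  shows "lincomb u Y (\<lambda>g. if g \<in> X then c g else 0) = lincomb u X c"
proof -
  have "lincomb u Y (\<lambda>g. if g \<in> X then c g else 0) = lincomb u X (\<lambda>g. if g \<in> X then c g else 0)"
    by (rule lincomb_mono_neutral) (use assms in auto)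
  also have "\<dots> = lincomb u X c" by (rule lincomb_cong) simp
  finally show ?thesis .
qed

lemma lincomb_insert:
  "finite X \<Longrightarrow> f \<notin> X \<Longrightarrow> lincomb u (insert f X) c = c f *\<^sub>R u f + lincomb u X c"
  by (simp add: lincomb_def)

lemma lincomb_single:
  assumes "finite X" "f \<in> X"
  shows "lincomb u X (\<lambda>g. if g = f then t else 0) = t *\<^sub>R u f"
proof -
  have "lincomb u X (\<lambda>g. if g = f then t else 0) = lincomb u {f} (\<lambda>g. if g = f then t else 0)"
    by (rule lincomb_mono_neutral) (use assms in auto)
  then show ?thesis by (simp add: lincomb_def)
qed

lemma indep_familyD: "indep_family u X \<Longrightarrow> lincomb u X c = 0 \<Longrightarrow> g \<in> X \<Longrightarrow> c g = 0"
  by (auto simp: indep_family_def)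

lemma indep_family_unique:
  assumes "indep_family u X" "lincomb u X c = lincomb u X d" "g \<in> X"
  shows "c g = d g"
  using indep_familyD[OF assms(1), of "\<lambda>g. c g - d g" g] assms by (simp add: lincomb_diff)

lemma indep_family_subset:
  assumes "indep_family u Y" "X \<subseteq> Y" "finite Y"
  shows "indep_family u X"
  unfolding indep_family_def
proof (intro allI impI ballI)
  fix c g assume "lincomb u X c = 0" "g \<in> X"
  then show "c g = 0"
    using indep_familyD[OF assms(1), of "\<lambda>g. if g \<in> X then c g else 0" g] lincomb_extend[of Y X u c] assms
    by auto
qed

lemma lincomb_in_span: "Y \<subseteq> X \<Longrightarrow> lincomb u Y c \<in> span (u ` X)"
  unfolding lincomb_def by (intro span_sum span_scale span_base) auto

lemma span_image_eq_range_lincomb: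
  assumes "finite X"
  shows "span (u ` X) = range (lincomb u X)"
proof
  show "range (lincomb u X) \<subseteq> span (u ` X)" using lincomb_in_span[of X X u] by auto
  show "span (u ` X) \<subseteq> range (lincomb u X)"
  proof (rule span_minimal)
    show "u ` X \<subseteq> range (lincomb u X)"
    proof
      fix x assume "x \<in> u ` X"
      then obtain g where "g \<in> X" "x = 1 *\<^sub>R u g" by auto
      then show "x \<in> range (lincomb u X)" by (metis lincomb_single[OF assms] rangeI)
    qed
    show "subspace (range (lincomb u X))"
      unfolding subspace_def
    proof (intro conjI ballI allI)
      show "0 \<in> range (lincomb u X)" by (rule range_eqI[of _ _ "\<lambda>_. 0"]) (simp add: lincomb_def)
      fix x assume "x \<in> range (lincomb u X)"
      then obtain c where x: "x = lincomb u X c" by auto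
      show "t *\<^sub>R x \<in> range (lincomb u X)" for t
        using lincomb_scale[of u X t c] x by (metis rangeI)
      fix y assume "y \<in> range (lincomb u X)"
      then obtain d where y: "y = lincomb u X d" by auto
      then show "x + y \<in> range (lincomb u X)"
        using lincomb_add[of u X c d] x by (metis rangeI)
    qed
  qed
qed

lemma indep_family_insert:
  assumes "finite X" "indep_family u X" "f \<notin> X"
  shows "indep_family u (insert f X) \<longleftrightarrow> u f \<notin> span (u ` X)"
proof
  assume ind: "indep_family u (insert f X)"
  show "u f \<notin> span (u ` X)"
  proof
    assume "u f \<in> span (u ` X)"
    then obtain c where c: "u f = lincomb u X c"
      using span_image_eq_range_lincomb[OF assms(1), of u] by auto
    have "lincomb u X (c(f := -1)) = lincomb u X c" by (rule lincomb_cong) (use assms in auto)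
    then have "lincomb u (insert f X) (c(f := -1)) = 0"
      using assms c by (simp add: lincomb_insert)
    from indep_familyD[OF ind this, of f] show False by simp
  qed
next
  assume nin: "u f \<notin> span (u ` X)"
  show "indep_family u (insert f X)"
    unfolding indep_family_def
  proof (intro allI impI ballI)
    fix c g assume c: "lincomb u (insert f X) c = 0" and g: "g \<in> insert f X"
    have eq: "c f *\<^sub>R u f + lincomb u X c = 0" using c assms by (simp add: lincomb_insert)
    have cf: "c f = 0"
    proof (rule ccontr)
      assume "c f \<noteq> 0"
      have "c f *\<^sub>R u f = - lincomb u X c" using eq by (simp add: eq_neg_iff_add_eq_0)
      then have "c f *\<^sub>R u f \<in> span (u ` X)" using lincomb_in_span[of X X u c] span_neg by auto
      then have "(1 / c f) *\<^sub>R (c f *\<^sub>R u f) \<in> span (u ` X)" by (rule span_scale)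
      then show False using nin \<open>c f \<noteq> 0\<close> by simp
    qed
    then have "lincomb u X c = 0" using eq by simp
    then show "c g = 0" using cf g indep_familyD[OF assms(2)] by blast
  qed
qed

lemma indep_family_iff:
  assumes "finite X"
  shows "indep_family u X \<longleftrightarrow> inj_on u X \<and> independent (u ` X)"
  using assms
proof (induction X)
  case empty
  then show ?case by (simp add: indep_family_def independent_empty)
next
  case (insert f X)
  show ?case
  proof (cases "indep_family u X")
    case True
    then have "indep_family u (insert f X) \<longleftrightarrow> u f \<notin> span (u ` X)"
      using indep_family_insert[OF insert.hyps(1) True insert.hyps(2)] by simp
    then show ?thesis
      using insert.hyps insert.IH True
      by (auto simp: independent_insert span_base split: if_splits)
  next
    case False
    have 1: "\<not> indep_family u (insert f X)" 
      using False indep_family_subset[of u "insert f X" X] insert.hyps by auto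
    have "\<not> (inj_on u (insert f X) \<and> independent (u ` insert f X))"
      using insert False by (metis independent_mono inj_on_subset image_mono subset_insertI)
    then show ?thesis using 1 by simp
  qed
qed

text \<open>Greedy completion. \<open>F\<close> may be unrelated to \<open>Y\<close>, which later
  allows independent columns to be completed by unit vectors.\<close>

lemma exists_basis_extending:
  assumes "finite F" "finite Y" "indep_family u Y"
  shows "\<exists>X. Y \<subseteq> X \<and> X \<subseteq> Y \<union> F \<and> indep_family u X \<and> u ` F \<subseteq> span (u ` X)"
  using assms(1)
proof (induction F)
  case empty
  then show ?case using assms by (intro exI[of _ Y]) auto
next
  case (insert f F)
  then obtain X where X: "Y \<subseteq> X" "X \<subseteq> Y \<union> F" "indep_family u X" "u ` F \<subseteq> span (u ` X)" by auto
  have fin: "finite X" using X(2) assms(2) insert.hyps(1) by (auto intro: finite_subset)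
  show ?case
  proof (cases "u f \<in> span (u ` X)")
    case True
    then show ?thesis using X by (intro exI[of _ X]) auto
  next
    case False
    then have "f \<notin> X" using span_base[of "u f" "u ` X"] by auto
    then have "indep_family u (insert f X)"
      using indep_family_insert[OF fin X(3)] False by simp
    moreover have "span (u ` X) \<subseteq> span (u ` insert f X)" by (intro span_mono) auto
    ultimately show ?thesis using X by (intro exI[of _ "insert f X"]) (auto simp: span_base)
  qed
qed

lemma indep_family_empty: "indep_family u {}"
  by (simp add: indep_family_def)

lemma exists_basis:
  assumes "finite F"
  shows "\<exists>X\<subseteq>F. indep_family u X \<and> u ` F \<subseteq> span (u ` X)"
  using exists_basis_extending[OF assms finite.emptyI indep_family_empty] by auto

lemma dim_image_eq_card:
  assumes "finite E" "X \<subseteq> E" "indep_family u X" "u ` E \<subseteq> span (u ` X)"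
  shows "dim (u ` E) = card X"
proof -
  have fin: "finite X" using assms finite_subset by blast
  have "span (u ` X) = span (u ` E)"
    using assms by (metis image_mono span_mono span_minimal subspace_span subset_antisym)
  then have "dim (u ` E) = card (u ` X)"
    using assms fin by (intro dim_eq_card) (auto simp: indep_family_iff)
  then show ?thesis using assms fin by (auto simp: indep_family_iff card_image)
qed

text \<open>The support of the coordinates of \<open>u f\<close> is the fundamental circuit of
  \<open>f\<close> without \<open>f\<close>, hence a matroid invariant. This is what makes
  coordinates in two representations comparable.\<close>

lemma lincomb_exchange:
  assumes "finite X" "f \<notin> X" "b \<in> X" "indep_family u X" "u f = lincomb u X c"
  shows "indep_family u (insert f (X - {b})) \<longleftrightarrow> c b \<noteq> 0"
proof -
  have ind: "indep_family u (X - {b})" using assms indep_family_subset by blast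
  have "u f \<in> span (u ` (X - {b})) \<longleftrightarrow> c b = 0"
  proof
    assume "u f \<in> span (u ` (X - {b}))"
    then obtain d where d: "u f = lincomb u (X - {b}) d"
      using assms span_image_eq_range_lincomb[of "X - {b}" u] by auto
    have "lincomb u X c = lincomb u X (\<lambda>g. if g \<in> X - {b} then d g else 0)"
      using lincomb_extend[of X "X - {b}" u d] assms d by auto
    from indep_family_unique[OF assms(4) this assms(3)] show "c b = 0" by simp
  next
    assume "c b = 0"
    then have "u f = lincomb u (X - {b}) c"
      using assms lincomb_mono_neutral[of X "X - {b}" c u] by auto
    then show "u f \<in> span (u ` (X - {b}))" using lincomb_in_span by (metis order_refl)
  qed
  then show ?thesis using indep_family_insert[OF _ ind, of f] assms by auto
qed

text \<open>A Caratheodory argument for the l1 norm. The norm bound serves the lattice points of the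
  polytope, the bound on the support serves circuits through a given vector.\<close>

lemma sparse_lincomb:
  assumes "finite S"
  shows "\<exists>C d. C \<subseteq> {g \<in> S. c g \<noteq> 0} \<and> indep_family u C \<and> (\<forall>g\<in>C. d g \<noteq> 0) \<and>
    lincomb u C d = lincomb u S c \<and> (\<Sum>g\<in>C. \<bar>d g\<bar>) \<le> (\<Sum>g\<in>S. \<bar>c g\<bar>)"
  using assms
proof (induction "card S" arbitrary: S c rule: less_induct)
  case less
  consider k where "k \<in> S" "c k = 0" | "\<forall>g\<in>S. c g \<noteq> 0" "indep_family u S"
    | y where "\<forall>g\<in>S. c g \<noteq> 0" "lincomb u S y = 0" "\<exists>g\<in>S. y g \<noteq> 0"
    by (auto simp: indep_family_def)
  then show ?case
  proof cases
    case (1 k)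
    have "card (S - {k}) < card S" using less.prems 1 by (intro psubset_card_mono) auto
    from less(1)[OF this, of c] obtain C d where Cd: "C \<subseteq> {g \<in> S - {k}. c g \<noteq> 0}" "indep_family u C"
      "\<forall>g\<in>C. d g \<noteq> 0" "lincomb u C d = lincomb u (S - {k}) c"
      "(\<Sum>g\<in>C. \<bar>d g\<bar>) \<le> (\<Sum>g\<in>S - {k}. \<bar>c g\<bar>)"
      using less.prems by blast
    moreover have "lincomb u (S - {k}) c = lincomb u S c"
      by (rule lincomb_mono_neutral[symmetric]) (use less.prems 1 in auto)
    moreover have "(\<Sum>g\<in>S - {k}. \<bar>c g\<bar>) \<le> (\<Sum>g\<in>S. \<bar>c g\<bar>)"
      using less.prems by (intro sum_mono2) auto
    moreover have "C \<subseteq> {g \<in> S. c g \<noteq> 0}" using Cd by auto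
    ultimately show ?thesis by (intro exI[of _ C] exI[of _ d] conjI) (assumption | linarith | simp)+
  next
    case 2
    then show ?thesis by (intro exI[of _ S] exI[of _ c]) auto
  next
    case (3 y0)
    \<comment> \<open>Move \<open>c\<close> along a relation in the direction that does not increase the \<open>l\<^sup>1\<close> norm, until
      the first coefficient vanishes.\<close>
    define y where "y = (if (\<Sum>g\<in>S. sgn (c g) * y0 g) \<ge> 0 then y0 else (\<lambda>g. (-1) * y0 g))"
    have y: "lincomb u S y = 0" "\<exists>g\<in>S. y g \<noteq> 0" "(\<Sum>g\<in>S. sgn (c g) * y g) \<ge> 0"
      using 3 unfolding y_def lincomb_scale by (auto simp: lincomb_scale lincomb_def sum_negf)
    define G where "G = {g \<in> S. sgn (c g) * y g > 0}"
    have "G \<noteq> {}"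
    proof
      assume "G = {}"
      then have le: "\<forall>g\<in>S. sgn (c g) * y g \<le> 0" by (auto simp: G_def not_less)
      then have "(\<Sum>g\<in>S. sgn (c g) * y g) \<le> 0" by (intro sum_nonpos) auto
      then have "(\<Sum>g\<in>S. sgn (c g) * y g) = 0" using y(3) by simp
      then have "\<forall>g\<in>S. sgn (c g) * y g = 0"
        using le less.prems sum_nonneg_eq_0_iff[of S "\<lambda>g. - (sgn (c g) * y g)"] by (simp add: sum_negf)
      then show False using y(2) 3(1) by (metis mult_eq_0_iff sgn_zero_iff)
    qed
    \<comment> \<open>\<open>G\<close> holds the coefficients that move towards 0, and
      \<open>t\<close> is the first time one of them arrives. Until then no coefficient changes
      sign, so the norm is an affine function of the time, with slope at most 0.\<close>
    define t where "t = Min ((\<lambda>g. \<bar>c g\<bar> / \<bar>y g\<bar>) ` G)"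
    have finG: "finite G" using less.prems by (auto simp: G_def)
    have "t \<in> (\<lambda>g. \<bar>c g\<bar> / \<bar>y g\<bar>) ` G" unfolding t_def using finG \<open>G \<noteq> {}\<close> by (intro Min_in) auto
    then obtain k where k: "k \<in> G" "t = \<bar>c k\<bar> / \<bar>y k\<bar>" by auto
    have tle: "t \<le> \<bar>c g\<bar> / \<bar>y g\<bar>" if "g \<in> G" for g
      unfolding t_def using finG that by (intro Min_le) auto
    have t0: "t \<ge> 0" using k by simp
    define c' where "c' = (\<lambda>g. c g - t * y g)"
    have lin: "lincomb u S c' = lincomb u S c"
      unfolding c'_def by (simp add: lincomb_diff lincomb_scale y)
    have abs: "\<bar>c' g\<bar> = \<bar>c g\<bar> - t * (sgn (c g) * y g)" if "g \<in> S" for g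
    proof -
      have s: "sgn (c g) * sgn (c g) = 1" using 3(1) that by (auto simp: sgn_if)
      have c: "c g = sgn (c g) * \<bar>c g\<bar>" by (simp add: sgn_mult_abs)
      have "t * (sgn (c g) * y g) \<le> \<bar>c g\<bar>"
      proof (cases "g \<in> G")
        case True
        then have "y g \<noteq> 0" by (auto simp: G_def)
        then have "t * \<bar>y g\<bar> \<le> \<bar>c g\<bar>" using tle[OF True] by (simp add: pos_le_divide_eq)
        moreover have "sgn (c g) * y g \<le> \<bar>y g\<bar>" by (auto simp: sgn_if)
        ultimately show ?thesis using mult_left_mono[OF _ t0] by fastforce
      next
        case False
        then have "sgn (c g) * y g \<le> 0" using that by (auto simp: G_def not_less)
        then have "t * (sgn (c g) * y g) \<le> 0" using t0 by (simp add: mult_nonneg_nonpos)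
        then show ?thesis by linarith
      qed
      moreover have "c' g = sgn (c g) * (\<bar>c g\<bar> - t * (sgn (c g) * y g))"
      proof -
        have "sgn (c g) * (\<bar>c g\<bar> - t * (sgn (c g) * y g))
          = sgn (c g) * \<bar>c g\<bar> - (sgn (c g) * sgn (c g)) * (t * y g)"
          by (simp add: algebra_simps)
        then show ?thesis using s c by (simp add: c'_def)
      qed
      moreover have "\<bar>sgn (c g)\<bar> = 1" using 3(1) that by (auto simp: sgn_if)
      ultimately show ?thesis by (simp add: abs_mult)
    qed
    have c'k: "c' k = 0"
    proof -
      have "sgn (c k) * y k > 0" "k \<in> S" using k by (auto simp: G_def)
      then have "sgn (c k) * y k = \<bar>y k\<bar>" "y k \<noteq> 0" by (auto simp: sgn_if split: if_splits)
      then show ?thesis using abs[OF \<open>k \<in> S\<close>] k(2) by simp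
    qed
    have norm: "(\<Sum>g\<in>S. \<bar>c' g\<bar>) \<le> (\<Sum>g\<in>S. \<bar>c g\<bar>)"
    proof -
      have "(\<Sum>g\<in>S. \<bar>c' g\<bar>) = (\<Sum>g\<in>S. \<bar>c g\<bar>) - t * (\<Sum>g\<in>S. sgn (c g) * y g)"
        using abs by (simp add: sum_subtractf sum_distrib_left)
      then show ?thesis using t0 y(3) by simp
    qed
    have kS: "k \<in> S" using k by (auto simp: G_def)
    then have "card (S - {k}) < card S" using less.prems by (intro psubset_card_mono) auto
    from less(1)[OF this, of c'] obtain C d where Cd: "C \<subseteq> {g \<in> S - {k}. c' g \<noteq> 0}" "indep_family u C"
      "\<forall>g\<in>C. d g \<noteq> 0" "lincomb u C d = lincomb u (S - {k}) c'"
      "(\<Sum>g\<in>C. \<bar>d g\<bar>) \<le> (\<Sum>g\<in>S - {k}. \<bar>c' g\<bar>)"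
      using less.prems by blast
    moreover have "lincomb u (S - {k}) c' = lincomb u S c"
      using lincomb_mono_neutral[of S "S - {k}" c' u] less.prems c'k lin by force
    moreover have "(\<Sum>g\<in>S - {k}. \<bar>c' g\<bar>) \<le> (\<Sum>g\<in>S. \<bar>c' g\<bar>)"
      using less.prems by (intro sum_mono2) auto
    moreover have "C \<subseteq> {g \<in> S. c g \<noteq> 0}" using Cd 3 by auto
    ultimately show ?thesis using norm by (intro exI[of _ C] exI[of _ d] conjI) (assumption | linarith | simp)+
  qed
qed

section \<open>Separators of a vector configuration\<close>

text \<open>Equivalently, \<open>C\<close> together with \<open>p\<close> is a circuit once
  \<open>p\<close> is adjoined as a further element.\<close>

definition minimal_rep :: "('a \<Rightarrow> 'v :: real_vector) \<Rightarrow> 'v \<Rightarrow> 'a set \<Rightarrow> bool" where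
  "minimal_rep u p C \<longleftrightarrow> indep_family u C \<and> (\<exists>c. lincomb u C c = p \<and> (\<forall>g\<in>C. c g \<noteq> 0))"

text \<open>The elements of \<open>F\<close> that share a circuit with the adjoined
  \<open>p\<close>.\<close>

definition reach :: "('a \<Rightarrow> 'v :: real_vector) \<Rightarrow> 'a set \<Rightarrow> 'v \<Rightarrow> 'a set" where
  "reach u F p = \<Union>{C. C \<subseteq> F \<and> minimal_rep u p C}"

lemma minimal_rep_within_support:
  assumes "finite S"
  shows "\<exists>C \<subseteq> {g \<in> S. c g \<noteq> 0}. minimal_rep u (lincomb u S c) C"
  using sparse_lincomb[OF assms, of c u] unfolding minimal_rep_def by blast

lemma minimal_rep_in_indep:
  assumes "finite X" "indep_family u X" "D \<subseteq> X" "minimal_rep u (lincomb u X c) D" "g \<in> X" "c g \<noteq> 0"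
  shows "g \<in> D"
proof (rule ccontr)
  assume "g \<notin> D"
  obtain d where "lincomb u D d = lincomb u X c" using assms by (auto simp: minimal_rep_def)
  then have "lincomb u X (\<lambda>h. if h \<in> D then d h else 0) = lincomb u X c"
    using lincomb_extend[OF assms(1,3), of u d] by simp
  from indep_family_unique[OF assms(2) this assms(5)] \<open>g \<notin> D\<close> assms(6) show False by simp
qed

text \<open>Circuit elimination: while \<open>C \<union> D\<close> is dependent, a relation removes
  an element of \<open>D - C\<close> from the representation of \<open>q\<close>. In the end
  \<open>p\<close> and \<open>q\<close> both have coordinates in one independent set, where these
  are unique.\<close>

lemma minimal_rep_union_indep:
  assumes "finite C" "finite D" "minimal_rep u p C" "minimal_rep u q D" "C \<inter> D \<noteq> {}"
  shows "\<exists>D' \<subseteq> C \<union> D. minimal_rep u q D' \<and> C \<inter> D' \<noteq> {} \<and> indep_family u (C \<union> D')"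
  using assms
proof (induction "card (C \<union> D)" arbitrary: D rule: less_induct)
  case less
  have fin: "finite (C \<union> D)" using less.prems by simp
  show ?case
  proof (cases "indep_family u (C \<union> D)")
    case True
    then show ?thesis using less.prems by blast
  next
    case False
    then obtain z k where z: "lincomb u (C \<union> D) z = 0" "k \<in> C \<union> D" "z k \<noteq> 0"
      unfolding indep_family_def by blast
    \<comment> \<open>\<open>C\<close> is independent, so a relation on the union cannot live on
      \<open>C\<close> alone.\<close>
    obtain h where h: "h \<in> D" "h \<notin> C" "z h \<noteq> 0"
    proof (cases "\<exists>h \<in> D - C. z h \<noteq> 0")
      case True
      then show ?thesis using that by blast
    next
      case False
      then have "lincomb u C z = 0"
        using lincomb_mono_neutral[OF fin, of C z u] z by auto
      moreover have "indep_family u C" using less.prems(3) unfolding minimal_rep_def by simp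
      ultimately have "z k = 0" if "k \<in> C" using that indep_familyD by metis
      then show ?thesis using z False by blast
    qed
    obtain d where d: "lincomb u D d = q" "\<forall>g\<in>D. d g \<noteq> 0" and indD: "indep_family u D"
      using less.prems(4) unfolding minimal_rep_def by blast
    define d' where "d' = (\<lambda>g. (if g \<in> D then d g else 0) - d h / z h * z g)"
    have d'q: "lincomb u (C \<union> D) d' = q"
      unfolding d'_def lincomb_diff lincomb_scale
      using lincomb_extend[OF fin, of D u d] z d by simp
    have d'h: "d' h = 0" using h by (simp add: d'_def)
    obtain D'' where D'': "D'' \<subseteq> {g \<in> C \<union> D. d' g \<noteq> 0}" "minimal_rep u q D''"
      using minimal_rep_within_support[OF fin, of d' u] d'q by auto
    have hD'': "h \<notin> D''" using D'' d'h by auto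
    \<comment> \<open>A representation avoiding \<open>C\<close> would lie in \<open>D\<close>,
      where the unique coordinates of \<open>q\<close> involve \<open>h\<close>.\<close>
    have meet: "C \<inter> D'' \<noteq> {}"
    proof
      assume "C \<inter> D'' = {}"
      then have "D'' \<subseteq> D" using D'' by auto
      from minimal_rep_in_indep[OF less.prems(2) indD this _ h(1), of d] d D'' h hD''
      show False by auto
    qed
    have sub: "C \<union> D'' \<subseteq> C \<union> D - {h}" using D'' hD'' h by auto
    have "card (C \<union> D'') < card (C \<union> D)"
      using fin sub h by (intro psubset_card_mono) auto
    moreover have "finite D''" using sub fin by (metis finite_Un finite_Diff finite_subset)
    ultimately obtain D' where "D' \<subseteq> C \<union> D''" "minimal_rep u q D'" "C \<inter> D' \<noteq> {}" "indep_family u (C \<union> D')"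
      using less.hyps[of D''] less.prems D'' meet by auto
    then show ?thesis using sub by blast
  qed
qed

text \<open>One step of connectivity: a circuit through \<open>h\<close> that meets a circuit
  through \<open>p\<close> puts \<open>h\<close> itself on a circuit through
  \<open>p\<close>.\<close>

lemma reach_exchange:
  assumes "finite F" "C \<subseteq> F" "minimal_rep u p C" "D \<subseteq> F" "h \<in> F" "minimal_rep u (u h) D" "C \<inter> D \<noteq> {}"
  shows "h \<in> reach u F p"
proof -
  have fin: "finite C" "finite D" using assms finite_subset by auto
  obtain D' where D': "D' \<subseteq> C \<union> D" "minimal_rep u (u h) D'" "C \<inter> D' \<noteq> {}" "indep_family u (C \<union> D')"
    using minimal_rep_union_indep[OF fin assms(3) assms(6,7)] by blast
  define X where "X = C \<union> D'"
  have X: "finite X" "indep_family u X" "X \<subseteq> F" "C \<subseteq> X" "D' \<subseteq> X"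
    unfolding X_def using D' fin assms by (auto intro: finite_subset)
  show ?thesis
  proof (cases "h \<in> X")
    \<comment> \<open>Inside the independent \<open>X\<close> the only minimal representation of
      \<open>u h\<close> is \<open>{h}\<close>. Since it meets \<open>C\<close>, already
      \<open>h \<in> C\<close>.\<close>
    case True
    have finD': "finite D'" using X finite_subset by blast
    obtain d where d: "lincomb u D' d = u h" "\<forall>g\<in>D'. d g \<noteq> 0"
      using D' unfolding minimal_rep_def by blast
    have same: "lincomb u X (\<lambda>g. if g \<in> D' then d g else 0) = lincomb u X (\<lambda>g. if g = h then 1 else 0)"
      using lincomb_extend[of X D' u d] lincomb_single[of X h u 1] X True d by simp
    have eq: "(if g \<in> D' then d g else 0) = (if g = h then 1 else 0)" if "g \<in> X" for g
      using indep_family_unique[OF X(2) same that] by simp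
    have "D' \<subseteq> {h}"
    proof
      fix g assume "g \<in> D'"
      then show "g \<in> {h}" using eq[of g] d(2) X(5) by (auto split: if_splits)
    qed
    then have "h \<in> C" using D' by auto
    then show ?thesis using assms by (auto simp: reach_def)
  next
    case False
    obtain k where k: "k \<in> C" "k \<in> D'" using D' by auto
    obtain c where c: "lincomb u C c = p" "\<forall>g\<in>C. c g \<noteq> 0"
      using assms(3) unfolding minimal_rep_def by blast
    obtain d where d: "lincomb u D' d = u h" "\<forall>g\<in>D'. d g \<noteq> 0"
      using D' unfolding minimal_rep_def by blast
    define cX where "cX = (\<lambda>g. if g \<in> C then c g else 0)"
    define dX where "dX = (\<lambda>g. if g \<in> D' then d g else 0)"
    have pX: "lincomb u X cX = p" "lincomb u X dX = u h"
      unfolding cX_def dX_def using lincomb_extend X c d by metis+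
    \<comment> \<open>Trades \<open>k\<close> for \<open>h\<close>: the multiple of the relation
      between \<open>h\<close> and \<open>D'\<close> that cancels the coefficient of
      \<open>k\<close> is subtracted.\<close>
    define t where "t = c k / d k"
    define c' where "c' = (\<lambda>g. if g = h then t else cX g - t * dX g)"
    have "lincomb u X c' = lincomb u X (\<lambda>g. cX g - t * dX g)"
      unfolding c'_def using False by (intro lincomb_cong) auto
    then have "lincomb u X c' = p - t *\<^sub>R u h" by (simp add: lincomb_diff lincomb_scale pX)
    then have c'p: "lincomb u (insert h X) c' = p"
      using X False by (simp add: lincomb_insert c'_def)
    obtain C' where C': "C' \<subseteq> {g \<in> insert h X. c' g \<noteq> 0}" "minimal_rep u p C'"
      using minimal_rep_within_support[of "insert h X" c' u] c'p X by auto
    have "c' k = 0" using k d False X by (auto simp: c'_def cX_def dX_def t_def)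
    then have "k \<notin> C'" using C' by auto
    \<comment> \<open>Without \<open>h\<close>, the representation would lie in \<open>X\<close> and
      hence contain all of \<open>C\<close>, including the cancelled \<open>k\<close>.\<close>
    have "h \<in> C'"
    proof (rule ccontr)
      assume "h \<notin> C'"
      then have "C' \<subseteq> X" using C' by auto
      from minimal_rep_in_indep[OF X(1,2) this, of cX k] pX C' k X c \<open>k \<notin> C'\<close>
      show False by (auto simp: cX_def)
    qed
    then show ?thesis using C' X assms unfolding reach_def by blast
  qed
qed

text \<open>\<open>reach u F p\<close> is a union of connected components of the matroid of \<open>u\<close> on \<open>F\<close>.\<close>

lemma reach_separates:
  assumes "finite F" "lincomb u F z = 0"
  shows "lincomb u (F \<inter> reach u F p) z = 0"
  using assms(2)
proof (induction "card {g \<in> F. z g \<noteq> 0}" arbitrary: z rule: less_induct)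
  case less
  define P where "P = F \<inter> reach u F p"
  define Z where "Z = {g \<in> F. z g \<noteq> 0}"
  have finZ: "finite Z" "Z \<subseteq> F" using assms by (auto simp: Z_def)
  have finP: "finite P" "P \<subseteq> F" using assms by (auto simp: P_def)
  show ?case
  proof (cases "\<exists>y. lincomb u F y = 0 \<and> {g \<in> F. y g \<noteq> 0} \<subset> Z \<and> (\<exists>g\<in>F. y g \<noteq> 0)")
    case True
    \<comment> \<open>The support of \<open>z\<close> is not a circuit, so \<open>z\<close> splits
      into two relations of smaller support.\<close>
    then obtain y k where y: "lincomb u F y = 0" "{g \<in> F. y g \<noteq> 0} \<subset> Z" "k \<in> F" "y k \<noteq> 0" by blast
    define z' where "z' = (\<lambda>g. z g - z k / y k * y g)"
    have z'0: "lincomb u F z' = 0" unfolding z'_def lincomb_diff lincomb_scale by (simp add: y less.prems)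
    have "{g \<in> F. z' g \<noteq> 0} \<subseteq> Z - {k}"
      using y unfolding z'_def Z_def by auto
    moreover have "k \<in> Z" using y by auto
    ultimately have "card {g \<in> F. z' g \<noteq> 0} < card Z"
      using finZ by (intro psubset_card_mono) auto
    then have 1: "lincomb u P z' = 0" using less.hyps[of z'] z'0 unfolding Z_def P_def by simp
    have "card {g \<in> F. y g \<noteq> 0} < card Z" using psubset_card_mono[OF finZ(1) y(2)] .
    then have 2: "lincomb u P y = 0" using less.hyps[of y] y(1) unfolding Z_def P_def by simp
    show ?thesis using 1 2 unfolding z'_def lincomb_diff lincomb_scale P_def by simp
  next
    case False
    \<comment> \<open>From here on the support \<open>Z\<close> is a circuit, and it suffices that
      it lies in \<open>P\<close> or misses \<open>P\<close>.\<close>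
    have zero: "lincomb u P z = 0" if "Z \<inter> P = {}"
    proof -
      have "\<forall>g\<in>P. z g = 0" using that finP unfolding Z_def by auto
      then show ?thesis unfolding lincomb_def by (intro sum.neutral) simp
    qed
    have all: "lincomb u P z = 0" if "Z \<subseteq> P"
    proof -
      have "lincomb u F z = lincomb u P z"
        by (rule lincomb_mono_neutral) (use assms that finP in \<open>auto simp: Z_def\<close>)
      then show ?thesis using less.prems by simp
    qed
    \<comment> \<open>If the circuit crossed the boundary of \<open>P\<close>, then
      \<open>Z - {h}\<close> would represent \<open>u h\<close> and contain \<open>g\<close>, so
      that the exchange step would put \<open>h\<close> into \<open>P\<close> as well.\<close>
    have "False" if g: "g \<in> Z \<inter> P" and h: "h \<in> Z - P" for g h
    proof -
      have "g \<noteq> h" using g h by auto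
      define D where "D = Z - {h}"
      have finD: "finite D" "D \<subseteq> F" using finZ by (auto simp: D_def)
      have indD: "indep_family u D"
        unfolding indep_family_def
      proof (intro allI impI ballI)
        fix y a assume y: "lincomb u D y = 0" "a \<in> D"
        define y' where "y' = (\<lambda>g. if g \<in> D then y g else 0)"
        have "lincomb u F y' = 0" unfolding y'_def using lincomb_extend[OF assms(1) finD(2), of u y] y by simp
        moreover have "{g \<in> F. y' g \<noteq> 0} \<subset> Z" using h by (auto simp: y'_def D_def)
        ultimately have "y' a = 0" using False y finD by blast
        then show "y a = 0" using y by (simp add: y'_def)
      qed
      have "lincomb u F z = lincomb u Z z"
        by (rule lincomb_mono_neutral) (use assms in \<open>auto simp: Z_def\<close>)
      moreover have "Z = insert h D" using h by (auto simp: D_def)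
      moreover have "h \<notin> D" by (simp add: D_def)
      ultimately have "z h *\<^sub>R u h + lincomb u D z = 0"
        using less.prems finD by (simp add: lincomb_insert)
      then have "lincomb u D z = - (z h *\<^sub>R u h)" by (simp add: eq_neg_iff_add_eq_0 add.commute)
      moreover have "z h \<noteq> 0" using h by (auto simp: Z_def)
      ultimately have "lincomb u D (\<lambda>g. (-1 / z h) * z g) = u h"
        unfolding lincomb_scale by simp
      moreover have "\<forall>g\<in>D. (-1 / z h) * z g \<noteq> 0" using \<open>z h \<noteq> 0\<close> by (auto simp: D_def Z_def)
      ultimately have rep: "minimal_rep u (u h) D" unfolding minimal_rep_def using indD by blast
      obtain C where C: "g \<in> C" "C \<subseteq> F" "minimal_rep u p C"
        using g unfolding P_def reach_def by auto
      have "g \<in> D" using g \<open>g \<noteq> h\<close> by (auto simp: D_def)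
      then have meet: "C \<inter> D \<noteq> {}" using C(1) by blast
      have "h \<in> F" using h finZ by blast
      have "h \<in> reach u F p" using reach_exchange[OF assms(1) C(2,3) finD(2) \<open>h \<in> F\<close> rep meet] .
      then show False using h \<open>h \<in> F\<close> unfolding P_def by blast
    qed
    then have "Z \<inter> P = {} \<or> Z \<subseteq> P" by blast
    then show ?thesis using zero all unfolding P_def by blast
  qed
qed

text \<open>Unimodularity as a property of the linear relations alone: it refers to no rows, so it
  makes sense for families in different spaces and survives changes of sign.\<close>

definition unimodular_family :: "('a \<Rightarrow> 'v :: real_vector) \<Rightarrow> 'a set \<Rightarrow> bool" where
  "unimodular_family u E \<longleftrightarrow>
    (\<forall>X g c. X \<subseteq> E \<and> indep_family u X \<and> g \<in> E \<and> u g = lincomb u X c \<longrightarrow> (\<forall>b\<in>X. c b \<in> {-1, 0, 1}))"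

lemma unimodular_familyD:
  assumes "unimodular_family u E" "X \<subseteq> E" "indep_family u X" "g \<in> E" "u g = lincomb u X c" "b \<in> X"
  shows "c b \<in> {-1, 0, 1}"
  using assms unfolding unimodular_family_def by blast

lemma unimodular_family_subset:
  "unimodular_family u E \<Longrightarrow> F \<subseteq> E \<Longrightarrow> unimodular_family u F"
  unfolding unimodular_family_def by blast

text \<open>For vectors \<open>p + q\<close> and \<open>p - q\<close> with coordinates \<open>c + d\<close> and \<open>c - d\<close> in
  \<open>{-1, 0, 1}\<close> of equal support, \<open>p\<close> and \<open>q\<close> have disjoint supports in every independent
  set, so the parts of the ground set reached from \<open>p\<close> and from \<open>q\<close> are disjoint separators.\<close>

lemma reach_disjoint:
  assumes "finite F"
    and "\<And>X c d. X \<subseteq> F \<Longrightarrow> indep_family u X \<Longrightarrow> lincomb u X c = p \<Longrightarrow> lincomb u X d = q \<Longrightarrow>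
      \<forall>b\<in>X. c b = 0 \<or> d b = 0"
  shows "reach u F p \<inter> reach u F q = {}"
proof (rule ccontr)
  assume "reach u F p \<inter> reach u F q \<noteq> {}"
  then obtain g C D where C: "g \<in> C" "C \<subseteq> F" "minimal_rep u p C" and D: "g \<in> D" "D \<subseteq> F" "minimal_rep u q D"
    by (auto simp: reach_def)
  have fin: "finite C" "finite D" 
    using finite_subset[OF C(2) assms(1)] finite_subset[OF D(2) assms(1)] by auto
  have meet: "C \<inter> D \<noteq> {}" using C(1) D(1) by blast
  obtain D' where D': "D' \<subseteq> C \<union> D" "minimal_rep u q D'" "C \<inter> D' \<noteq> {}" "indep_family u (C \<union> D')"
    using minimal_rep_union_indep[OF fin C(3) D(3) meet] by blast
  obtain c where c: "lincomb u C c = p" "\<forall>g\<in>C. c g \<noteq> 0" using C unfolding minimal_rep_def by blast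
  obtain d where d: "lincomb u D' d = q" "\<forall>g\<in>D'. d g \<noteq> 0" using D' unfolding minimal_rep_def by blast
  have fin': "finite (C \<union> D')" using D' fin by (auto intro: finite_subset)
  obtain k where k: "k \<in> C" "k \<in> D'" using D' by auto
  have "C \<union> D' \<subseteq> F" using C(2) D(2) D'(1) by blast
  from assms(2)[OF this D'(4), of "\<lambda>g. if g \<in> C then c g else 0" "\<lambda>g. if g \<in> D' then d g else 0"]
  have disj: "\<forall>b\<in>C \<union> D'. (if b \<in> C then c b else 0) = 0 \<or> (if b \<in> D' then d b else 0) = 0"
    using lincomb_extend[OF fin', of C u c] lincomb_extend[OF fin', of D' u d] c(1) d(1) by simp
  have "c k = 0 \<or> d k = 0" using bspec[OF disj, of k] k by simp
  then show False using c(2) d(2) k by blast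
qed

section \<open>Uniqueness of unimodular representations\<close>

text \<open>Flipping the signs on a separator subtracts twice the part of \<open>z\<close> on it,
  and that part is a relation by itself.\<close>

lemma lincomb_sign_separator:
  assumes "finite F" "lincomb u F z = 0" "\<And>g. g \<in> F \<Longrightarrow> \<tau> g = (if g \<in> reach u F q then -1 else 1)"
  shows "lincomb u F (\<lambda>g. \<tau> g * z g) = 0"
proof -
  define S where "S = F \<inter> reach u F q"
  have "lincomb u F (\<lambda>g. \<tau> g * z g) = lincomb u F (\<lambda>g. z g - 2 * (if g \<in> S then z g else 0))"
    by (rule lincomb_cong) (use assms(3) in \<open>auto simp: S_def\<close>)
  also have "\<dots> = lincomb u F z - 2 *\<^sub>R lincomb u S z"
    unfolding lincomb_diff lincomb_scale using lincomb_extend[OF assms(1), of S u z] by (simp add: S_def)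
  also have "\<dots> = 0" using reach_separates[OF assms(1,2), of q] assms(2) by (simp add: S_def)
  finally show ?thesis .
qed

lemma lincomb_insert_coloop:
  assumes "finite F" "f \<notin> F" "u f \<notin> span (u ` F)" "lincomb u (insert f F) z = 0"
  shows "z f = 0"
proof (rule ccontr)
  assume "z f \<noteq> 0"
  have "z f *\<^sub>R u f = - lincomb u F z"
    using assms(4) lincomb_insert[OF assms(1,2), of u z] by (simp add: eq_neg_iff_add_eq_0)
  then have "z f *\<^sub>R u f \<in> span (u ` F)" using lincomb_in_span[of F F u z] span_neg by auto
  then have "(1 / z f) *\<^sub>R (z f *\<^sub>R u f) \<in> span (u ` F)" by (rule span_scale)
  then show False using assms(3) \<open>z f \<noteq> 0\<close> by simp
qed

text \<open>The induction step of uniqueness, with the kernels on \<open>F\<close> already equal. If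
  \<open>f\<close> lies in the span of \<open>F\<close>, what is sought is a sign vector that turns
  the coordinates of \<open>u f\<close> into those of \<open>w f\<close> and maps the kernel on
  \<open>F\<close> to itself.\<close>

lemma unimodular_family_extend_signing:
  fixes u :: "'a \<Rightarrow> 'v :: real_vector" and w :: "'a \<Rightarrow> 'w :: real_vector"
  assumes fin: "finite F" and f: "f \<notin> F"
    and uni: "unimodular_family u (insert f F)" "unimodular_family w (insert f F)"
    and ind: "\<And>X. X \<subseteq> insert f F \<Longrightarrow> indep_family u X \<longleftrightarrow> indep_family w X"
    and ker: "\<And>z. lincomb u F z = 0 \<longleftrightarrow> lincomb w F z = 0"
  shows "\<exists>\<tau> :: 'a \<Rightarrow> real. (\<forall>g. \<tau> g \<in> {1, -1}) \<and>
    (\<forall>z. lincomb u (insert f F) z = 0 \<longleftrightarrow> lincomb w (insert f F) (\<lambda>g. \<tau> g * z g) = 0)"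
proof -
  have same: "lincomb u F a = lincomb u F b \<longleftrightarrow> lincomb w F a = lincomb w F b" for a b
    using ker[of "\<lambda>g. a g - b g"] by (simp add: lincomb_diff)
  have ext: "lincomb u Y (\<lambda>g. if g \<in> X then c g else 0) = lincomb u X c"
    "lincomb w Y (\<lambda>g. if g \<in> X then c g else 0) = lincomb w X c"
    if "X \<subseteq> Y" "finite Y" for X Y c
    by (rule lincomb_extend[OF that(2,1)])+
  obtain X where X: "X \<subseteq> F" "indep_family u X" "u ` F \<subseteq> span (u ` X)"
    using exists_basis[OF fin] by blast
  have finX: "finite X" using X(1) fin by (rule finite_subset)
  have indwX: "indep_family w X" using ind[of X] X by auto
  have spanw: "w ` F \<subseteq> span (w ` X)"
  proof
    fix x assume "x \<in> w ` F"
    then obtain g where g: "g \<in> F" "x = w g" by auto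
    then have "u g \<in> span (u ` X)" using X by auto
    then obtain c where c: "u g = lincomb u X c"
      using span_image_eq_range_lincomb[OF finX, of u] by auto
    have "lincomb u F (\<lambda>h. if h = g then 1 else 0) = lincomb u F (\<lambda>h. if h \<in> X then c h else 0)"
      using ext(1)[OF X(1) fin, of c] lincomb_single[OF fin g(1), of u 1] c by simp
    then have "w g = lincomb w X c"
      unfolding same using ext(2)[OF X(1) fin, of c] lincomb_single[OF fin g(1), of w 1] by simp
    then show "x \<in> span (w ` X)" using g lincomb_in_span[of X X w c] by simp
  qed
  have spanX: "span (u ` F) = span (u ` X)"
    by (rule subset_antisym[OF span_minimal[OF X(3) subspace_span] span_mono[OF image_mono[OF X(1)]]])
  have spanwX: "span (w ` F) = span (w ` X)"
    by (rule subset_antisym[OF span_minimal[OF spanw subspace_span] span_mono[OF image_mono[OF X(1)]]])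
  have "f \<notin> X" "insert f X \<subseteq> insert f F" using f X(1) by auto
  then have mem: "u f \<in> span (u ` F) \<longleftrightarrow> w f \<in> span (w ` F)"
    using indep_family_insert[OF finX X(2), of f] indep_family_insert[OF finX indwX, of f]
      ind[of "insert f X"] unfolding spanX spanwX by simp
  show ?thesis
  proof (cases "u f \<in> span (u ` F)")
    \<comment> \<open>Here \<open>f\<close> is a coloop: it occurs in no relation, and all signs can
      be 1.\<close>
    case False
    have "lincomb u (insert f F) z = 0 \<longleftrightarrow> lincomb w (insert f F) z = 0" for z
    proof (cases "z f = 0")
      case True
      then show ?thesis unfolding lincomb_insert[OF fin f] using ker[of z] by simp
    next
      case z: False
      show ?thesis
        using lincomb_insert_coloop[where f = f, OF fin f False, of z] z
          lincomb_insert_coloop[where f = f, OF fin f, of w z] False mem by blast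
    qed
    then show ?thesis by (intro exI[of _ "\<lambda>_. 1"]) auto
  next
    case True
    have "u f \<in> range (lincomb u X)"
      using True unfolding spanX span_image_eq_range_lincomb[OF finX] .
    then obtain c0 where c0: "u f = lincomb u X c0" by (rule rangeE)
    have "w f \<in> range (lincomb w X)"
      using True unfolding mem unfolding spanwX span_image_eq_range_lincomb[OF finX] .
    then obtain d0 where d0: "w f = lincomb w X d0" by (rule rangeE)
    define c where "c = (\<lambda>g. if g \<in> X then c0 g else 0)"
    define d where "d = (\<lambda>g. if g \<in> X then d0 g else 0)"
    have cF: "lincomb u F c = u f" unfolding c_def using ext(1)[OF X(1) fin, of c0] c0 by simp
    have dF: "lincomb w F d = w f" unfolding d_def using ext(2)[OF X(1) fin, of d0] d0 by simp
    \<comment> \<open>\<open>lincomb u F d\<close> is \<open>w f\<close> transported to the space of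
      \<open>u\<close>, which makes sense because the kernels on \<open>F\<close> agree. Half the
      sum and half the difference with \<open>u f\<close> collect the coordinates that agree and
      those that are opposite.\<close>
    define p where "p = lincomb u F (\<lambda>g. 1/2 * (c g + d g))"
    define q where "q = lincomb u F (\<lambda>g. 1/2 * (c g - d g))"
    have pq: "p + q = u f" "p - q = lincomb u F d"
      unfolding p_def q_def lincomb_scale lincomb_add lincomb_diff cF
      by (simp_all add: scaleR_add_right[symmetric] scaleR_diff_right[symmetric] flip: scaleR_2)
    \<comment> \<open>In every independent \<open>Y\<close> the two versions of \<open>f\<close>
      have coordinates in {-1, 0, 1} with equal supports, by the exchange criterion. Thus at each
      place they agree or are opposite, and one of \<open>a\<close>, \<open>a'\<close>
      vanishes.\<close>
    have key: "\<forall>b\<in>Y. a b + a' b \<in> {-1, 0, 1} \<and> a b - a' b \<in> {-1, 0, 1} \<and> (a b = 0 \<or> a' b = 0)"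
      if Y: "Y \<subseteq> F" "indep_family u Y" "lincomb u Y a = p" "lincomb u Y a' = q" for Y a a'
    proof
      fix b assume b: "b \<in> Y"
      have finY: "finite Y" using Y(1) fin by (rule finite_subset)
      have indwY: "indep_family w Y" using ind[of Y] Y by auto
      have 1: "u f = lincomb u Y (\<lambda>g. a g + a' g)" using Y pq by (simp add: lincomb_add)
      have "lincomb u F (\<lambda>g. if g \<in> Y then a g - a' g else 0) = lincomb u F d"
        using ext(1)[OF Y(1) fin, of "\<lambda>g. a g - a' g"] Y pq by (simp add: lincomb_diff)
      then have 2: "w f = lincomb w Y (\<lambda>g. a g - a' g)"
        unfolding same using ext(2)[OF Y(1) fin, of "\<lambda>g. a g - a' g"] dF by simp
      have fY: "f \<notin> Y" using f Y by auto
      have "a b + a' b \<noteq> 0 \<longleftrightarrow> a b - a' b \<noteq> 0"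
        using lincomb_exchange[OF finY fY b Y(2) 1] lincomb_exchange[OF finY fY b indwY 2]
          ind[of "insert f (Y - {b})"] Y(1) by auto
      moreover have "a b + a' b \<in> {-1, 0, 1}"
        by (rule unimodular_familyD[OF uni(1) _ Y(2) _ 1 b]) (use Y(1) in auto)
      moreover have "a b - a' b \<in> {-1, 0, 1}"
        by (rule unimodular_familyD[OF uni(2) _ indwY _ 2 b]) (use Y(1) in auto)
      ultimately show "a b + a' b \<in> {-1, 0, 1} \<and> a b - a' b \<in> {-1, 0, 1} \<and> (a b = 0 \<or> a' b = 0)"
        by auto
    qed
    have disj: "reach u F p \<inter> reach u F q = {}"
      using reach_disjoint[OF fin, of u p q] key by blast
    define S where "S = reach u F q"
    \<comment> \<open>Flip on the part reached from \<open>q\<close>. Places where the coordinates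
      agree are reached from \<open>p\<close>, hence remain unflipped by disjointness.\<close>
    define \<tau> :: "'a \<Rightarrow> real" where "\<tau> = (\<lambda>g. if g \<in> F \<inter> S then -1 else 1)"
    have \<tau>: "\<tau> g \<in> {1, -1}" "\<tau> g * \<tau> g = 1" for g by (auto simp: \<tau>_def)
    have \<tau>f: "\<tau> f = 1" using f by (simp add: \<tau>_def)
    have pX: "lincomb u X (\<lambda>g. 1/2 * (c g + d g)) = p" "lincomb u X (\<lambda>g. 1/2 * (c g - d g)) = q"
      unfolding p_def q_def
      by (rule lincomb_mono_neutral[symmetric]; use X(1) fin in \<open>auto simp: c_def d_def\<close>)+
    have in_reach: "g \<in> reach u F (lincomb u X a)" if "g \<in> X" "a g \<noteq> 0" for g a
    proof -
      obtain C where C: "C \<subseteq> {g \<in> X. a g \<noteq> 0}" "minimal_rep u (lincomb u X a) C"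
        using minimal_rep_within_support[OF finX] by blast
      then have "C \<subseteq> X" by auto
      then have "g \<in> C" using minimal_rep_in_indep[OF finX X(2) _ C(2) that] by simp
      then show ?thesis using C \<open>C \<subseteq> X\<close> X(1) unfolding reach_def by blast
    qed
    have \<tau>c: "\<tau> g * c g = d g" if g: "g \<in> F" for g
    proof (cases "g \<in> X")
      case False
      then show ?thesis by (simp add: c_def d_def)
    next
      case True
      consider "c g = d g" "c g \<noteq> 0" | "c g = 0" "d g = 0" | "d g = - c g" "c g \<noteq> 0"
        using bspec[OF key[OF X(1,2) pX] True] by fastforce
      then show ?thesis
      proof cases
        case 1
        then have "g \<in> reach u F p" using in_reach[OF True, of "\<lambda>g. 1/2 * (c g + d g)"] pX by auto
        then show ?thesis using disj 1 by (auto simp: \<tau>_def S_def)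
      next
        case 3
        then have "g \<in> reach u F q" using in_reach[OF True, of "\<lambda>g. 1/2 * (c g - d g)"] pX by auto
        then show ?thesis using 3 g by (auto simp: \<tau>_def S_def)
      qed auto
    qed
    have flip: "lincomb u F (\<lambda>g. \<tau> g * z g) = 0" if "lincomb u F z = 0" for z
      using lincomb_sign_separator[OF fin that, of \<tau> q] by (simp add: \<tau>_def S_def)
    have flip_iff: "lincomb u F (\<lambda>g. \<tau> g * z g) = 0 \<longleftrightarrow> lincomb u F z = 0" for z
      using flip[of z] flip[of "\<lambda>g. \<tau> g * z g"] by (auto simp: \<tau> simp flip: mult.assoc)
    \<comment> \<open>Write \<open>f\<close> by its coordinates over \<open>F\<close>; the flip
      preserves the kernel there and turns \<open>c\<close> into \<open>d\<close>.\<close>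
    have "lincomb u (insert f F) z = 0 \<longleftrightarrow> lincomb w (insert f F) (\<lambda>g. \<tau> g * z g) = 0" for z
    proof -
      have "lincomb u (insert f F) z = lincomb u F (\<lambda>g. z f * c g + z g)"
        by (simp add: lincomb_insert fin f lincomb_add lincomb_scale cF)
      also have "\<dots> = 0 \<longleftrightarrow> lincomb w F (\<lambda>g. \<tau> g * (z f * c g + z g)) = 0"
        unfolding ker[symmetric] flip_iff ..
      also have "lincomb w F (\<lambda>g. \<tau> g * (z f * c g + z g)) = lincomb w F (\<lambda>g. z f * d g + \<tau> g * z g)"
        by (rule lincomb_cong) (simp add: \<tau>c[symmetric] algebra_simps)
      also have "\<dots> = lincomb w (insert f F) (\<lambda>g. \<tau> g * z g)"
        unfolding lincomb_add lincomb_scale dF lincomb_insert[OF fin f] by (simp add: \<tau>f)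
      finally show ?thesis .
    qed
    then show ?thesis using \<tau>(1) by (intro exI[of _ \<tau>]) blast
  qed
qed

theorem unimodular_family_unique:
  fixes u :: "'a \<Rightarrow> 'v :: real_vector" and v :: "'a \<Rightarrow> 'w :: real_vector"
  assumes "finite E" "unimodular_family u E" "unimodular_family v E"
    and "\<And>X. X \<subseteq> E \<Longrightarrow> indep_family u X \<longleftrightarrow> indep_family v X"
  shows "\<exists>\<sigma> :: 'a \<Rightarrow> real. (\<forall>g. \<sigma> g \<in> {1, -1}) \<and>
    (\<forall>z. lincomb u E z = 0 \<longleftrightarrow> lincomb v E (\<lambda>g. \<sigma> g * z g) = 0)"
  using assms
proof (induction E)
  case empty
  then show ?case by (intro exI[of _ "\<lambda>_. 1"]) (simp add: lincomb_def)
next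
  case (insert f F)
  have "\<exists>\<sigma> :: 'a \<Rightarrow> real. (\<forall>g. \<sigma> g \<in> {1, -1}) \<and>
    (\<forall>z. lincomb u F z = 0 \<longleftrightarrow> lincomb v F (\<lambda>g. \<sigma> g * z g) = 0)"
  proof (rule insert.IH)
    show "unimodular_family u F" "unimodular_family v F"
      using unimodular_family_subset[OF insert.prems(1)] unimodular_family_subset[OF insert.prems(2)] by auto
    show "indep_family u X \<longleftrightarrow> indep_family v X" if "X \<subseteq> F" for X
      using insert.prems(3)[of X] that by auto
  qed
  then obtain \<sigma> :: "'a \<Rightarrow> real" where \<sigma>: "\<And>g. \<sigma> g \<in> {1, -1}"
    "\<And>z. lincomb u F z = 0 \<longleftrightarrow> lincomb v F (\<lambda>g. \<sigma> g * z g) = 0"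
    by blast
  \<comment> \<open>Absorbing the signs found on \<open>F\<close> into \<open>v\<close> makes the
    two kernels on \<open>F\<close> equal, as the extension step requires.\<close>
  define w where "w = (\<lambda>g. \<sigma> g *\<^sub>R v g)"
  have \<sigma>2: "\<sigma> g * \<sigma> g = 1" for g using \<sigma>(1)[of g] by auto
  have lw: "lincomb w X c = lincomb v X (\<lambda>g. \<sigma> g * c g)" for X c
    by (simp add: w_def lincomb_def mult.commute)
  have lv: "lincomb v X c = lincomb w X (\<lambda>g. \<sigma> g * c g)" for X c
    unfolding lw by (simp add: \<sigma>2 flip: mult.assoc)
  have \<sigma>0: "\<sigma> g \<noteq> 0" for g using \<sigma>(1)[of g] by auto
  have indw: "indep_family w X \<longleftrightarrow> indep_family v X" for X
  proof
    assume "indep_family w X"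
    then show "indep_family v X" unfolding indep_family_def lv using \<sigma>0 by fastforce
  next
    assume "indep_family v X"
    then show "indep_family w X" unfolding indep_family_def lw using \<sigma>0 by fastforce
  qed
  have uniw: "unimodular_family w (insert f F)"
    unfolding unimodular_family_def
  proof (intro allI impI ballI, elim conjE)
    fix X g c b
    assume X: "X \<subseteq> insert f F" "indep_family w X" "g \<in> insert f F" "w g = lincomb w X c" and b: "b \<in> X"
    have "v g = \<sigma> g *\<^sub>R w g" by (simp add: w_def \<sigma>2)
    then have "v g = lincomb v X (\<lambda>h. \<sigma> g * (\<sigma> h * c h))"
      unfolding lincomb_scale X(4) lw by simp
    from unimodular_familyD[OF insert.prems(2) X(1) _ X(3) this b] X(2)
    have "\<sigma> g * (\<sigma> b * c b) \<in> {-1, 0, 1}" by (simp add: indw)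
    then show "c b \<in> {-1, 0, 1}" using \<sigma>(1)[of g] \<sigma>(1)[of b] by auto
  qed
  have ker: "lincomb u F z = 0 \<longleftrightarrow> lincomb w F z = 0" for z unfolding lw by (rule \<sigma>(2))
  have indep_eq: "indep_family u X \<longleftrightarrow> indep_family w X" if "X \<subseteq> insert f F" for X
    unfolding indw by (rule insert.prems(3)[OF that])
  have "\<exists>\<tau> :: 'a \<Rightarrow> real. (\<forall>g. \<tau> g \<in> {1, -1}) \<and>
    (\<forall>z. lincomb u (insert f F) z = 0 \<longleftrightarrow> lincomb w (insert f F) (\<lambda>g. \<tau> g * z g) = 0)"
    by (rule unimodular_family_extend_signing[OF insert.hyps insert.prems(1) uniw indep_eq ker])
  then obtain \<tau> :: "'a \<Rightarrow> real" where \<tau>: "\<forall>g. \<tau> g \<in> {1, -1}"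
    "\<forall>z. lincomb u (insert f F) z = 0 \<longleftrightarrow> lincomb w (insert f F) (\<lambda>g. \<tau> g * z g) = 0"
    by (elim exE conjE)
  have "lincomb u (insert f F) z = 0 \<longleftrightarrow> lincomb v (insert f F) (\<lambda>g. (\<sigma> g * \<tau> g) * z g) = 0" for z
    using spec[OF \<tau>(2), of z] unfolding lw by (simp add: mult.assoc)
  moreover have "\<sigma> g * \<tau> g \<in> {1, -1}" for g using \<sigma>(1)[of g] spec[OF \<tau>(1), of g] by auto
  ultimately show ?case by (intro exI[of _ "\<lambda>g. \<sigma> g * \<tau> g"]) blast
qed

section \<open>Totally unimodular matrices\<close>

abbreviation submatrix :: "('a \<Rightarrow> real ^ 'm) \<Rightarrow> nat \<Rightarrow> (nat \<Rightarrow> 'm) \<Rightarrow> (nat \<Rightarrow> 'a) \<Rightarrow> real Matrix.mat" where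
  "submatrix A k r c \<equiv> Matrix.mat k k (\<lambda>(i, j). vec_nth (A (c j)) (r i))"

text \<open>The rows are those outside a set of unit vectors completing the columns to a basis.\<close>

lemma exists_nonsingular_rows:
  fixes A :: "'a \<Rightarrow> real ^ 'm"
  assumes "finite X" "indep_family A X" "bij_betw c {..<k} X"
  shows "\<exists>r. inj_on r {..<k} \<and> Determinant.det (submatrix A k r c) \<noteq> 0"
proof -
  \<comment> \<open>The sum type keeps a column that happens to be a unit vector apart from that
    unit vector.\<close>
  define w :: "'a + 'm \<Rightarrow> real ^ 'm" where "w = case_sum A (\<lambda>i. axis i 1)"
  have lin: "lincomb w (Inl ` X \<union> Inr ` I) y = lincomb A X (\<lambda>g. y (Inl g)) + (\<Sum>i\<in>I. y (Inr i) *\<^sub>R axis i 1)" for I y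
    unfolding lincomb_def
    by (subst sum.union_disjoint) (use assms in \<open>auto simp: sum.reindex w_def\<close>)
  have "indep_family w (Inl ` X)"
    unfolding indep_family_def using lin[of "{}"] assms(2) by (force simp: indep_family_def)
  then obtain B where B: "Inl ` X \<subseteq> B" "B \<subseteq> Inl ` X \<union> range Inr" "indep_family w B"
    "w ` range Inr \<subseteq> span (w ` B)"
    using exists_basis_extending[of "range Inr" "Inl ` X" w] assms by auto
  define I where "I = {i. Inr i \<in> B}"
  have BI: "B = Inl ` X \<union> Inr ` I" using B(1,2) by (auto simp: I_def)
  have finB: "finite B" unfolding BI using assms by simp
  have "dim (w ` B) = card B" using dim_image_eq_card[OF finB _ B(3)] by (auto intro: span_base)
  moreover have "span (w ` B) = UNIV"
  proof -
    have "(Basis :: (real ^ 'm) set) \<subseteq> w ` range Inr" by (force simp: Basis_vec_def w_def image_iff)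
    then have "span (Basis :: (real ^ 'm) set) \<subseteq> span (w ` B)"
      using B(4) by (intro span_minimal subspace_span) (rule order_trans)
    then show ?thesis by (simp add: top.extremum_uniqueI)
  qed
  then have "dim (w ` B) = dim (UNIV :: (real ^ 'm) set)" by (metis dim_span)
  ultimately have "card B = CARD('m)" by simp
  moreover have "card B = k + card I"
    unfolding BI using assms bij_betw_same_card[OF assms(3)]
    by (subst card_Un_disjoint) (auto simp: card_image)
  ultimately have "card (- I) = k" by (simp add: Compl_eq_Diff_UNIV card_Diff_subset)
  then obtain r where r: "bij_betw r {..<k} (- I)"
    by (metis card_lessThan finite_class.finite_code finite_lessThan finite_same_card_bij)
  have "Determinant.det (submatrix A k r c) \<noteq> 0"
  proof
    assume "Determinant.det (submatrix A k r c) = 0"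
    then obtain v where v: "v \<in> carrier_vec k" "v \<noteq> 0\<^sub>v k" "submatrix A k r c *\<^sub>v v = 0\<^sub>v k"
      using det_0_iff_vec_prod_zero[of "submatrix A k r c" k] by auto
    define y where "y g = vec_index v (the_inv_into {..<k} c g)" for g
    have yc: "y (c j) = vec_index v j" if "j < k" for j
      using that assms(3) by (simp add: y_def the_inv_into_f_f bij_betw_def)
    have lc: "lincomb A X y = (\<Sum>j<k. vec_index v j *\<^sub>R A (c j))"
      unfolding lincomb_def sum.reindex_bij_betw[OF assms(3), symmetric] by (simp add: yc)
    have "vec_nth (lincomb A X y) (r i) = 0" if "i < k" for i
    proof -
      have "vec_index (submatrix A k r c *\<^sub>v v) i = 0" using v that by simp
      then show ?thesis using that v(1) unfolding lc
        by (simp add: scalar_prod_def lessThan_atLeast0 mult.commute)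
    qed
    then have zero: "vec_nth (lincomb A X y) i = 0" if "i \<notin> I" for i
      using that r by (metis ComplI bij_betw_iff_bijections lessThan_iff)
    \<comment> \<open>The combination vanishes in all rows outside \<open>I\<close>, so the unit
      vectors in \<open>I\<close> cancel it. This gives a relation on the basis
      \<open>B\<close>.\<close>
    define y' where "y' = case_sum y (\<lambda>i. - vec_nth (lincomb A X y) i)"
    have "(\<Sum>i\<in>I. vec_nth (lincomb A X y) i *\<^sub>R axis i 1) = lincomb A X y"
    proof (subst Finite_Cartesian_Product.vec_eq_iff, rule allI)
      fix l
      have "vec_nth (\<Sum>i\<in>I. vec_nth (lincomb A X y) i *\<^sub>R axis i (1::real)) l
        = (\<Sum>i\<in>I. if i = l then vec_nth (lincomb A X y) l else 0)"
        unfolding sum_component by (rule sum.cong) (auto simp: axis_def)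
      then show "vec_nth (\<Sum>i\<in>I. vec_nth (lincomb A X y) i *\<^sub>R axis i (1::real)) l = vec_nth (lincomb A X y) l"
        using zero[of l] by (simp add: sum.delta)
    qed
    then have "lincomb w B y' = 0"
      unfolding BI lin by (simp add: y'_def sum_negf)
    from indep_familyD[OF B(3) this] have "y g = 0" if "g \<in> X" for g
      using B(1) that by (force simp: y'_def)
    then have "vec_index v j = 0" if "j < k" for j
      using yc[OF that] assms(3) that by (auto simp: bij_betw_def)
    then have "v = 0\<^sub>v k" using v(1) by (intro eq_vecI) auto
    then show False using v(2) by simp
  qed
  then show ?thesis using r by (auto simp: bij_betw_def)
qed

lemma det_in_Ints:
  assumes "\<And>i j. i < k \<Longrightarrow> j < k \<Longrightarrow> f i j \<in> \<int>"
  shows "Determinant.det (Matrix.mat k k (\<lambda>(i, j). f i j)) \<in> (\<int> :: real set)"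
proof -
  have "of_int (sign p) * (\<Prod>i = 0..<k. Matrix.mat k k (\<lambda>(i, j). f i j) $$ (i, p i)) \<in> \<int>"
    if "p permutes {0..<k}" for p
  proof (intro Ints_mult Ints_of_int Ints_prod)
    fix i assume "i \<in> {0..<k}"
    then show "Matrix.mat k k (\<lambda>(i, j). f i j) $$ (i, p i) \<in> \<int>"
      using assms permutes_in_image[OF that, of i] by auto
  qed
  then show ?thesis
    by (subst det_def'[of _ k]) (auto intro!: Ints_sum)
qed

lemma totally_unimodularD:
  assumes "totally_unimodular E A" "inj_on r {..<k}" "inj_on c {..<k}" "c ` {..<k} \<subseteq> E"
  shows "Determinant.det (submatrix A k r c) \<in> {-1, 0, 1}"
  using assms unfolding totally_unimodular_def by blast

text \<open>Cramer's rule on a nonsingular square submatrix, whose determinant \<open>D\<close> must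
  be \<plusminus>1. Up to sign, a coordinate is then a determinant; both its integrality and its
  bound by 1 are read off from this.\<close>

lemma totally_unimodular_cramer:
  fixes A :: "'a \<Rightarrow> real ^ 'm"
  assumes "totally_unimodular E A" "finite X" "X \<subseteq> E" "indep_family A X"
  shows "\<exists>k r c D. inj_on r {..<k} \<and> bij_betw c {..<k} X \<and> D \<in> {1, -1} \<and>
    (\<forall>y. \<forall>j<k. y (c j) * D =
      Determinant.det (Matrix.mat k k (\<lambda>(i, l). vec_nth (if l = j then lincomb A X y else A (c l)) (r i))))"
proof -
  obtain c where c: "bij_betw c {..<card X} X"
    using ex_bij_betw_nat_finite[OF assms(2)] by (auto simp: lessThan_atLeast0)
  define k where "k = card X"
  note c = c[folded k_def]
  obtain r where r: "inj_on r {..<k}" "Determinant.det (submatrix A k r c) \<noteq> 0"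
    using exists_nonsingular_rows[OF assms(2,4) c] by blast
  define D where "D = Determinant.det (submatrix A k r c)"
  have "D \<in> {-1, 0, 1}"
    unfolding D_def
    by (rule totally_unimodularD[OF assms(1) r(1)]) (use assms(3) c in \<open>auto simp: bij_betw_def\<close>)
  then have D: "D \<in> {1, -1}" using r by (auto simp: D_def)
  have "y (c j) * D =
      Determinant.det (Matrix.mat k k (\<lambda>(i, l). vec_nth (if l = j then lincomb A X y else A (c l)) (r i)))"
    if j: "j < k" for y j
  proof -
    let ?v = "Matrix.vec k (\<lambda>j. y (c j))"
    have "vec_index (submatrix A k r c *\<^sub>v ?v) i = vec_nth (lincomb A X y) (r i)" if "i < k" for i
      using that unfolding lincomb_def sum.reindex_bij_betw[OF c, symmetric]
      by (simp add: scalar_prod_def lessThan_atLeast0 mult.commute)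
    then have "replace_col (submatrix A k r c) (submatrix A k r c *\<^sub>v ?v) j =
      Matrix.mat k k (\<lambda>(i, l). vec_nth (if l = j then lincomb A X y else A (c l)) (r i))"
      by (intro eq_matI) (auto simp: replace_col_def)
    then show ?thesis
      using cramer_lemma_mat[of "submatrix A k r c" k ?v j] j by (simp add: D_def)
  qed
  then show ?thesis using r(1) c D by blast
qed

lemma totally_unimodular_entry:
  assumes "totally_unimodular E A" "g \<in> E"
  shows "vec_nth (A g) i \<in> {-1, 0, 1}"
proof -
  have "Determinant.det (submatrix A 1 (\<lambda>_. i) (\<lambda>_. g)) \<in> {-1, 0, 1}"
    by (rule totally_unimodularD[OF assms(1)]) (use assms(2) in \<open>auto simp: inj_on_def\<close>)
  then show ?thesis by (simp add: det_single)
qed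

lemma totally_unimodular_imp_unimodular_family:
  fixes A :: "'a \<Rightarrow> real ^ 'm"
  assumes "totally_unimodular E A" "finite E"
  shows "unimodular_family A E"
  unfolding unimodular_family_def
proof (intro allI impI ballI, elim conjE)
  fix X g y b
  assume X: "X \<subseteq> E" "indep_family A X" "g \<in> E" "A g = lincomb A X y" and b: "b \<in> X"
  have finX: "finite X" using X assms finite_subset by auto
  show "y b \<in> {-1, 0, 1}"
  proof (cases "g \<in> X")
    case True
    have "lincomb A X y = lincomb A X (\<lambda>h. if h = g then 1 else 0)"
      using lincomb_single[OF finX True, of A 1] X by simp
    from indep_family_unique[OF X(2) this b] show ?thesis by simp
  next
    case False
    obtain k r c D where *: "inj_on r {..<k}" "bij_betw c {..<k} X" "D \<in> {1, -1::real}"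
      "\<And>y j. j < k \<Longrightarrow> y (c j) * D =
        Determinant.det (Matrix.mat k k (\<lambda>(i, l). vec_nth (if l = j then lincomb A X y else A (c l)) (r i)))"
      using totally_unimodular_cramer[OF assms(1) finX X(1,2)] by blast
    obtain j where j: "j < k" "b = c j" using b *(2) by (auto simp: bij_betw_def)
    \<comment> \<open>The replaced column is \<open>A g\<close>, so the determinant is again a minor
      of the matrix; \<open>g \<notin> X\<close> keeps its columns distinct.\<close>
    have "Matrix.mat k k (\<lambda>(i, l). vec_nth (if l = j then lincomb A X y else A (c l)) (r i))
      = submatrix A k r (c(j := g))"
      by (intro eq_matI) (auto simp: X(4))
    moreover have "inj_on (c(j := g)) {..<k}" "(c(j := g)) ` {..<k} \<subseteq> E"
      using *(2) False X by (auto simp: bij_betw_def inj_on_def)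
    ultimately have "y b * D \<in> {-1, 0, 1}"
      using *(4)[OF j(1), of y] totally_unimodularD[OF assms(1) *(1)] j(2) by metis
    then show ?thesis using *(3) by auto
  qed
qed

lemma totally_unimodular_integral:
  fixes A :: "'a \<Rightarrow> real ^ 'm"
  assumes "totally_unimodular E A" "finite X" "X \<subseteq> E" "indep_family A X"
    and "\<And>i. vec_nth (lincomb A X y) i \<in> \<int>" and "b \<in> X"
  shows "y b \<in> \<int>"
proof -
  obtain k r c D where *: "bij_betw c {..<k} X" "D \<in> {1, -1::real}"
    "\<And>y j. j < k \<Longrightarrow> y (c j) * D =
      Determinant.det (Matrix.mat k k (\<lambda>(i, l). vec_nth (if l = j then lincomb A X y else A (c l)) (r i)))"
    using totally_unimodular_cramer[OF assms(1-4)] by blast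
  obtain j where j: "j < k" "b = c j" using assms(6) *(1) by (auto simp: bij_betw_def)
  have "vec_nth (A g) i \<in> \<int>" if "g \<in> X" for g i
    using totally_unimodular_entry[OF assms(1) subsetD[OF assms(3) that], of i]
    by (elim insertE) simp_all
  then have "y b * D \<in> \<int>"
    unfolding j(2) *(3)[OF j(1)] using *(1) assms(5)
    by (intro det_in_Ints) (auto simp: bij_betw_def)
  then show ?thesis using *(2) by auto
qed

section \<open>Lattice points of the symmetric edge polytope\<close>

text \<open>The word-metric ball around 0, described by coefficients so that balls in different
  spaces can be compared.\<close>

definition int_ball :: "('a \<Rightarrow> 'v :: real_vector) \<Rightarrow> 'a set \<Rightarrow> nat \<Rightarrow> 'v set" where
  "int_ball u E m = {lincomb u E (\<lambda>g. real_of_int (c g)) | c. (\<Sum>g\<in>E. \<bar>c g\<bar>) \<le> int m}"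

lemma int_ballI:
  "(\<Sum>g\<in>E. \<bar>c g\<bar>) \<le> int m \<Longrightarrow> lincomb u E (\<lambda>g. real_of_int (c g)) \<in> int_ball u E m"
  unfolding int_ball_def by blast

lemma int_ballE:
  assumes "x \<in> int_ball u E m"
  obtains c where "x = lincomb u E (\<lambda>g. real_of_int (c g))" "(\<Sum>g\<in>E. \<bar>c g\<bar>) \<le> int m"
  using assms unfolding int_ball_def by blast

lemma int_ball_mono: "m \<le> n \<Longrightarrow> int_ball u E m \<subseteq> int_ball u E n"
  unfolding int_ball_def by (auto intro: order_trans)

lemma int_ball_0:
  assumes "finite E"
  shows "int_ball u E 0 = {0}"
proof -
  have "lincomb u E (\<lambda>g. real_of_int (c g)) = 0" if "(\<Sum>g\<in>E. \<bar>c g\<bar>) \<le> 0" for c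
  proof -
    have "(\<Sum>g\<in>E. \<bar>c g\<bar>) = 0" using that by (intro antisym sum_nonneg) auto
    then have "\<forall>g\<in>E. c g = 0" using assms by (simp add: sum_nonneg_eq_0_iff)
    then show ?thesis by (simp add: lincomb_def)
  qed
  moreover have "lincomb u E (\<lambda>g. real_of_int 0) = 0" by (simp add: lincomb_def)
  ultimately show ?thesis unfolding int_ball_def by (auto intro!: exI[of _ "\<lambda>_. 0"])
qed

lemma finite_int_ball:
  assumes "finite E"
  shows "finite (int_ball u E m)"
proof (rule finite_subset)
  show "int_ball u E m \<subseteq> (\<lambda>c. lincomb u E (\<lambda>g. real_of_int (c g))) ` (PiE E (\<lambda>_. {- int m..int m}))"
  proof
    fix x assume "x \<in> int_ball u E m"
    then obtain c where c: "x = lincomb u E (\<lambda>g. real_of_int (c g))" "(\<Sum>g\<in>E. \<bar>c g\<bar>) \<le> int m"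
      by (rule int_ballE)
    have "\<bar>c g\<bar> \<le> int m" if "g \<in> E" for g
      using member_le_sum[of g E "\<lambda>g. \<bar>c g\<bar>"] that assms c(2) by auto
    then have "restrict c E \<in> PiE E (\<lambda>_. {- int m..int m})" by (fastforce simp: abs_le_iff)
    moreover have "x = lincomb u E (\<lambda>g. real_of_int (restrict c E g))"
      unfolding c(1) by (rule lincomb_cong) simp
    ultimately show "x \<in> (\<lambda>c. lincomb u E (\<lambda>g. real_of_int (c g))) ` (PiE E (\<lambda>_. {- int m..int m}))"
      by (intro image_eqI[of x _ "restrict c E"])
  qed
  show "finite ((\<lambda>c. lincomb u E (\<lambda>g. real_of_int (c g))) ` (PiE E (\<lambda>_. {- int m..int m})))"
    using assms by (intro finite_imageI finite_PiE) auto
qed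

lemma uminus_in_int_ball:
  assumes "x \<in> int_ball u E m"
  shows "- x \<in> int_ball u E m"
proof -
  obtain c where c: "x = lincomb u E (\<lambda>g. real_of_int (c g))" "(\<Sum>g\<in>E. \<bar>c g\<bar>) \<le> int m"
    using assms by (rule int_ballE)
  have "- x = lincomb u E (\<lambda>g. real_of_int (- c g))" unfolding c(1) lincomb_def by (simp add: sum_negf)
  moreover have "lincomb u E (\<lambda>g. real_of_int (- c g)) \<in> int_ball u E m"
    by (rule int_ballI) (use c in simp)
  ultimately show ?thesis by simp
qed

lemma int_ball_translate:
  assumes "finite E" "e \<in> E" "x \<in> int_ball u E m" "s \<in> {1, -1 :: int}"
  shows "x + real_of_int s *\<^sub>R u e \<in> int_ball u E (Suc m)"
proof -
  obtain c where c: "x = lincomb u E (\<lambda>g. real_of_int (c g))" "(\<Sum>g\<in>E. \<bar>c g\<bar>) \<le> int m"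
    using assms(3) by (rule int_ballE)
  define c' where "c' = (\<lambda>g. c g + (if g = e then s else 0))"
  have "x + real_of_int s *\<^sub>R u e = lincomb u E (\<lambda>g. real_of_int (c g) + (if g = e then real_of_int s else 0))"
    unfolding c(1) lincomb_add lincomb_single[OF assms(1,2)] ..
  also have "\<dots> = lincomb u E (\<lambda>g. real_of_int (c' g))"
    by (rule lincomb_cong) (simp add: c'_def)
  finally have 1: "x + real_of_int s *\<^sub>R u e = lincomb u E (\<lambda>g. real_of_int (c' g))" .
  have "(\<Sum>g\<in>E. \<bar>c' g\<bar>) \<le> (\<Sum>g\<in>E. \<bar>c g\<bar> + (if g = e then 1 else 0))"
    by (rule sum_mono) (use assms(4) in \<open>auto simp: c'_def\<close>)
  also have "\<dots> \<le> int (Suc m)"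
    using c(2) assms(1,2) by (simp add: sum.distrib sum.delta)
  finally show ?thesis unfolding 1 by (rule int_ballI)
qed

lemma sum_abs_combination_le:
  fixes c d :: "'a \<Rightarrow> real"
  shows "(\<Sum>g\<in>E. \<bar>s * c g + t * d g\<bar>) \<le> \<bar>s\<bar> * (\<Sum>g\<in>E. \<bar>c g\<bar>) + \<bar>t\<bar> * (\<Sum>g\<in>E. \<bar>d g\<bar>)"
proof -
  have "(\<Sum>g\<in>E. \<bar>s * c g + t * d g\<bar>) \<le> (\<Sum>g\<in>E. \<bar>s\<bar> * \<bar>c g\<bar> + \<bar>t\<bar> * \<bar>d g\<bar>)"
    by (rule sum_mono) (metis abs_mult abs_triangle_ineq)
  then show ?thesis by (simp add: sum.distrib sum_distrib_left)
qed

text \<open>The polytope is the linear image of the l1 unit ball (the cross-polytope). For empty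
  \<open>E\<close> this agrees with the convention \<open>{0}\<close>.\<close>

lemma symmetric_edge_polytope_eq:
  fixes A :: "'a \<Rightarrow> real ^ 'm"
  assumes "finite E"
  shows "symmetric_edge_polytope E A = {lincomb A E c | c. (\<Sum>g\<in>E. \<bar>c g\<bar>) \<le> 1}" (is "?P = ?Q")
proof (cases "E = {}")
  case True
  then show ?thesis by (auto simp: symmetric_edge_polytope_def lincomb_def)
next
  case False
  let ?U = "\<Union>u\<in>A ` E. {u, - u}"
  have P: "?P = convex hull ?U" using False by (simp add: symmetric_edge_polytope_def)
  show ?thesis
  proof
    show "?P \<subseteq> ?Q"
      unfolding P
    proof (rule hull_minimal)
      show "?U \<subseteq> ?Q"
      proof
        fix x assume "x \<in> ?U"
        then obtain g and s :: real where g: "g \<in> E" "x = s *\<^sub>R A g" "\<bar>s\<bar> = 1"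
          by (auto intro: that[of _ 1] that[of _ "-1"])
        have "(\<Sum>h\<in>E. \<bar>if h = g then s else 0\<bar>) = (\<Sum>h\<in>E. if h = g then 1 else 0)"
          using g(3) by (intro sum.cong) auto
        then have "(\<Sum>h\<in>E. \<bar>if h = g then s else 0\<bar>) \<le> 1" using assms by simp
        then show "x \<in> ?Q" using lincomb_single[OF assms g(1), of A s] g(2) by force
      qed
      show "convex ?Q"
      proof (rule convexI)
        fix x y and s t :: real
        assume "x \<in> ?Q" "y \<in> ?Q" and st: "0 \<le> s" "0 \<le> t" "s + t = 1"
        then obtain c d where c: "x = lincomb A E c" "(\<Sum>g\<in>E. \<bar>c g\<bar>) \<le> 1"
          and d: "y = lincomb A E d" "(\<Sum>g\<in>E. \<bar>d g\<bar>) \<le> 1" by blast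
        have "(\<Sum>g\<in>E. \<bar>s * c g + t * d g\<bar>) \<le> s * 1 + t * 1"
          using sum_abs_combination_le[of s c t d E] mult_left_mono[OF c(2) st(1)]
            mult_left_mono[OF d(2) st(2)] st by simp
        moreover have "s *\<^sub>R x + t *\<^sub>R y = lincomb A E (\<lambda>g. s * c g + t * d g)"
          unfolding c(1) d(1) lincomb_add lincomb_scale ..
        ultimately show "s *\<^sub>R x + t *\<^sub>R y \<in> ?Q" using st by auto
      qed
    qed
    have U: "A g \<in> ?P" "- A g \<in> ?P" if "g \<in> E" for g
      unfolding P using that by (auto intro!: hull_inc)
    have cvx: "convex ?P" unfolding P by (rule convex_convex_hull)
    have zero: "0 \<in> ?P"
    proof -
      obtain g where "g \<in> E" using False by auto
      from convexD[OF cvx U[OF this], of "1/2" "1/2"] show ?thesis by simp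
    qed
    show "?Q \<subseteq> ?P"
    proof
      fix x assume "x \<in> ?Q"
      then obtain c where c: "x = lincomb A E c" "(\<Sum>g\<in>E. \<bar>c g\<bar>) \<le> 1" by blast
      define s where "s = (\<Sum>g\<in>E. \<bar>c g\<bar>)"
      have s: "s \<ge> 0" "s \<le> 1" using c by (auto simp: s_def intro: sum_nonneg)
      show "x \<in> ?P"
      proof (cases "s = 0")
        case True
        then have "\<forall>g\<in>E. c g = 0" using assms by (simp add: s_def sum_nonneg_eq_0_iff)
        then have "x = 0" unfolding c(1) by (simp add: lincomb_def)
        then show ?thesis using zero by simp
      next
        case False
        \<comment> \<open>The signs move into the generators and the weights are normalised by
          \<open>s\<close>; scaling by \<open>s\<close> then moves the point back towards 0, which
          also lies in the polytope.\<close>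
        define y where "y g = (if c g \<ge> 0 then A g else - A g)" for g
        have "(\<Sum>g\<in>E. (\<bar>c g\<bar> / s) *\<^sub>R y g) \<in> ?P"
        proof (rule convex_sum[OF assms cvx])
          show "(\<Sum>g\<in>E. \<bar>c g\<bar> / s) = 1"
            using False unfolding s_def by (simp flip: sum_divide_distrib)
        qed (use s U in \<open>auto simp: y_def\<close>)
        from convexD[OF cvx this zero, of s "1 - s"]
        have "s *\<^sub>R (\<Sum>g\<in>E. (\<bar>c g\<bar> / s) *\<^sub>R y g) \<in> ?P" using s by simp
        moreover have "s *\<^sub>R (\<Sum>g\<in>E. (\<bar>c g\<bar> / s) *\<^sub>R y g) = x"
          unfolding c(1) lincomb_def scaleR_sum_right
          by (rule sum.cong) (use False in \<open>auto simp: y_def\<close>)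
        ultimately show ?thesis by simp
      qed
    qed
  qed
qed

lemma aff_dim_symmetric_edge_polytope:
  fixes A :: "'a \<Rightarrow> real ^ 'm"
  assumes "finite E"
  shows "aff_dim (symmetric_edge_polytope E A) = int (dim (A ` E))"
proof -
  let ?P = "symmetric_edge_polytope E A"
  have P: "?P = {lincomb A E c | c. (\<Sum>g\<in>E. \<bar>c g\<bar>) \<le> 1}"
    by (rule symmetric_edge_polytope_eq[OF assms])
  have "0 \<in> ?P"
    unfolding P by (rule CollectI, rule exI[of _ "\<lambda>_. 0 :: real"]) (simp add: lincomb_def)
  then have "aff_dim ?P = int (dim ?P)" by (intro aff_dim_zero hull_inc)
  moreover have "span ?P = span (A ` E)"
  proof (rule subset_antisym)
    show "span ?P \<subseteq> span (A ` E)"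
      unfolding P by (rule span_minimal) (auto intro: lincomb_in_span)
    have "A ` E \<subseteq> ?P"
    proof
      fix x assume "x \<in> A ` E"
      then show "x \<in> ?P"
        by (auto simp: symmetric_edge_polytope_def intro!: hull_inc)
    qed
    then show "span (A ` E) \<subseteq> span ?P" by (rule span_mono)
  qed
  ultimately show ?thesis by (metis dim_span)
qed

text \<open>Nothing is rounded numerically: the sparse form on an independent set has integer
  coefficients as soon as its value is integral, and its norm is no larger.\<close>

lemma totally_unimodular_rounding:
  fixes A :: "'a \<Rightarrow> real ^ 'm"
  assumes "totally_unimodular E A" "finite E" "\<And>i. vec_nth (lincomb A E c) i \<in> \<int>"
    "(\<Sum>g\<in>E. \<bar>c g\<bar>) \<le> real m"
  shows "lincomb A E c \<in> int_ball A E m"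
proof -
  obtain C d where C: "C \<subseteq> {g \<in> E. c g \<noteq> 0}" "indep_family A C"
    "lincomb A C d = lincomb A E c" "(\<Sum>g\<in>C. \<bar>d g\<bar>) \<le> (\<Sum>g\<in>E. \<bar>c g\<bar>)"
    using sparse_lincomb[OF assms(2), of c A] by blast
  have CE: "C \<subseteq> E" and finC: "finite C" using C(1) assms(2) by (auto intro: finite_subset)
  have int: "d g \<in> \<int>" if "g \<in> C" for g
    using totally_unimodular_integral[OF assms(1) finC CE C(2) _ that] assms(3) C(3) by simp
  define c' where "c' g = (if g \<in> C then \<lfloor>d g\<rfloor> else 0)" for g
  have c': "real_of_int (c' g) = (if g \<in> C then d g else 0)" for g
    using int by (auto simp: c'_def elim: Ints_cases)
  have "lincomb A E c = lincomb A E (\<lambda>g. real_of_int (c' g))"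
    unfolding c' lincomb_extend[OF assms(2) CE] using C(3) by simp
  moreover have "(\<Sum>g\<in>E. \<bar>c' g\<bar>) \<le> int m"
  proof -
    have "real_of_int (\<Sum>g\<in>E. \<bar>c' g\<bar>) = (\<Sum>g\<in>E. \<bar>if g \<in> C then d g else 0\<bar>)"
      unfolding of_int_sum of_int_abs c' ..
    also have "\<dots> = (\<Sum>g\<in>C. \<bar>d g\<bar>)"
      by (rule sum.mono_neutral_cong_right) (use assms(2) CE in auto)
    also have "\<dots> \<le> real m" using C(4) assms(4) by simp
    finally show ?thesis by linarith
  qed
  ultimately show ?thesis using int_ballI[of c' E m A] by simp
qed

lemma int_ball_integral:
  fixes A :: "'a \<Rightarrow> real ^ 'm"
  assumes "totally_unimodular E A" "x \<in> int_ball A E m"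
  shows "vec_nth x i \<in> \<int>"
proof -
  obtain c where c: "x = lincomb A E (\<lambda>g. real_of_int (c g))" using assms(2) by (rule int_ballE)
  have "vec_nth (A g) i \<in> \<int>" if "g \<in> E" for g
    using totally_unimodular_entry[OF assms(1) that, of i] by (elim insertE) simp_all
  then show ?thesis unfolding c lincomb_def sum_component by (intro Ints_sum) auto
qed

lemma lattice_point_count_eq_card_int_ball:
  fixes A :: "'a \<Rightarrow> real ^ 'm"
  assumes "totally_unimodular E A" "finite E"
  shows "lattice_point_count (symmetric_edge_polytope E A) m = card (int_ball A E m)"
proof (cases "m = 0")
  case True
  then show ?thesis by (simp add: lattice_point_count_def int_ball_0[OF assms(2)])
next
  case False
  let ?P = "symmetric_edge_polytope E A"
  have P: "?P = {lincomb A E c | c. (\<Sum>g\<in>E. \<bar>c g\<bar>) \<le> 1}"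
    by (rule symmetric_edge_polytope_eq[OF assms(2)])
  have "(\<lambda>x. real m *\<^sub>R x) ` ?P \<inter> {x. \<forall>i. vec_nth x i \<in> \<int>} = int_ball A E m"
  proof (intro subset_antisym subsetI)
    fix x assume x: "x \<in> (\<lambda>x. real m *\<^sub>R x) ` ?P \<inter> {x. \<forall>i. vec_nth x i \<in> \<int>}"
    then obtain c where c: "x = real m *\<^sub>R lincomb A E c" "(\<Sum>g\<in>E. \<bar>c g\<bar>) \<le> 1" unfolding P by auto
    have xm: "x = lincomb A E (\<lambda>g. real m * c g)" unfolding lincomb_scale by (rule c(1))
    have "(\<Sum>g\<in>E. \<bar>real m * c g\<bar>) = real m * (\<Sum>g\<in>E. \<bar>c g\<bar>)"
      by (simp add: abs_mult sum_distrib_left)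
    also have "\<dots> \<le> real m" using mult_left_mono[OF c(2), of "real m"] by simp
    finally show "x \<in> int_ball A E m"
      using totally_unimodular_rounding[OF assms, of "\<lambda>g. real m * c g" m] x xm by auto
  next
    fix x assume x: "x \<in> int_ball A E m"
    then obtain c where c: "x = lincomb A E (\<lambda>g. real_of_int (c g))" "(\<Sum>g\<in>E. \<bar>c g\<bar>) \<le> int m"
      by (rule int_ballE)
    define y where "y = lincomb A E (\<lambda>g. 1 / real m * real_of_int (c g))"
    have "(\<Sum>g\<in>E. \<bar>1 / real m * real_of_int (c g)\<bar>) = real_of_int (\<Sum>g\<in>E. \<bar>c g\<bar>) / real m"
      by (simp add: abs_mult sum_divide_distrib)
    also have "\<dots> \<le> 1"
    proof -
      have "real_of_int (\<Sum>g\<in>E. \<bar>c g\<bar>) \<le> real m" using c(2) by linarith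
      then show ?thesis using False by (simp del: of_int_sum)
    qed
    finally have "y \<in> ?P" unfolding P y_def by blast
    moreover have "x = real m *\<^sub>R y" unfolding y_def lincomb_scale c(1) using False by simp
    ultimately show "x \<in> (\<lambda>x. real m *\<^sub>R x) ` ?P \<inter> {x. \<forall>i. vec_nth x i \<in> \<int>}"
      using int_ball_integral[OF assms(1) x] by blast
  qed
  then show ?thesis using False by (simp add: lattice_point_count_def)
qed

section \<open>Contraction by pivoting\<close>

text \<open>Choose a short coefficient vector for each point and multiply it by the signs. The norm
  is unchanged, and the hypothesis on kernels makes the resulting map injective.\<close>

lemma card_int_ball_le_of_signing:
  fixes u :: "'a \<Rightarrow> 'v :: real_vector" and v :: "'a \<Rightarrow> 'w :: real_vector" and \<sigma> :: "'a \<Rightarrow> real"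
  assumes "finite E" "\<And>g. \<sigma> g \<in> {1, -1}"
    and ker: "\<And>z. lincomb u E z = 0 \<longleftrightarrow> lincomb v E (\<lambda>g. \<sigma> g * z g) = 0"
  shows "card (int_ball u E m) \<le> card (int_ball v E m)"
proof -
  define s :: "'a \<Rightarrow> int" where "s g = (if \<sigma> g = 1 then 1 else -1)" for g
  have s: "\<sigma> g = real_of_int (s g)" "\<bar>s g\<bar> = 1" for g
    using assms(2)[of g] by (auto simp: s_def)
  have "\<exists>c. x = lincomb u E (\<lambda>g. real_of_int (c g)) \<and> (\<Sum>g\<in>E. \<bar>c g\<bar>) \<le> int m" if "x \<in> int_ball u E m" for x
    using that unfolding int_ball_def by blast
  then obtain c where c: "\<And>x. x \<in> int_ball u E m \<Longrightarrow> x = lincomb u E (\<lambda>g. real_of_int (c x g))"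
    "\<And>x. x \<in> int_ball u E m \<Longrightarrow> (\<Sum>g\<in>E. \<bar>c x g\<bar>) \<le> int m" by metis
  define f where "f x = lincomb v E (\<lambda>g. real_of_int (s g * c x g))" for x
  show ?thesis
  proof (rule card_inj_on_le)
    show "f ` int_ball u E m \<subseteq> int_ball v E m"
    proof
      fix y assume "y \<in> f ` int_ball u E m"
      then obtain x where x: "x \<in> int_ball u E m" "y = f x" by auto
      have "(\<Sum>g\<in>E. \<bar>s g * c x g\<bar>) \<le> int m" using c(2)[OF x(1)] by (simp add: abs_mult s(2))
      then show "y \<in> int_ball v E m" unfolding x(2) f_def by (rule int_ballI)
    qed
    show "inj_on f (int_ball u E m)"
    proof (rule inj_onI)
      fix x y assume xy: "x \<in> int_ball u E m" "y \<in> int_ball u E m" "f x = f y"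
      have "lincomb v E (\<lambda>g. \<sigma> g * (real_of_int (c x g) - real_of_int (c y g))) = f x - f y"
        unfolding f_def lincomb_diff[symmetric] by (rule lincomb_cong) (simp add: s algebra_simps)
      then have "lincomb u E (\<lambda>g. real_of_int (c x g) - real_of_int (c y g)) = 0"
        unfolding ker using xy(3) by simp
      then show "x = y" unfolding lincomb_diff using c(1)[OF xy(1)] c(1)[OF xy(2)] by simp
    qed
    show "finite (int_ball v E m)" by (rule finite_int_ball[OF assms(1)])
  qed
qed

lemma card_int_ball_eq_of_signing:
  fixes \<sigma> :: "'a \<Rightarrow> real"
  assumes "finite E" "\<And>g. \<sigma> g \<in> {1, -1}"
    and ker: "\<And>z. lincomb u E z = 0 \<longleftrightarrow> lincomb v E (\<lambda>g. \<sigma> g * z g) = 0"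
  shows "card (int_ball u E m) = card (int_ball v E m)"
proof (rule antisym)
  show "card (int_ball u E m) \<le> card (int_ball v E m)"
    by (rule card_int_ball_le_of_signing[OF assms])
  have "\<sigma> g * \<sigma> g = 1" for g using assms(2)[of g] by auto
  then have "lincomb v E z = 0 \<longleftrightarrow> lincomb u E (\<lambda>g. \<sigma> g * z g) = 0" for z
    unfolding ker by (simp flip: mult.assoc)
  then show "card (int_ball v E m) \<le> card (int_ball u E m)"
    by (rule card_int_ball_le_of_signing[OF assms(1,2)])
qed

text \<open>For a nonzero pivot entry, the projection along \<open>A e\<close> onto the hyperplane
  where coordinate \<open>i\<close> vanishes. Row \<open>i\<close> stays as a zero row, so the
  contraction lives in the same space.\<close>

definition pivot :: "('a \<Rightarrow> real ^ 'm) \<Rightarrow> 'a \<Rightarrow> 'm \<Rightarrow> real ^ 'm \<Rightarrow> real ^ 'm" where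
  "pivot A e i x = x - (vec_nth x i / vec_nth (A e) i) *\<^sub>R A e"

lemma linear_pivot: "linear (pivot A e i)"
  by (rule linearI) (simp_all add: pivot_def algebra_simps add_divide_distrib)

lemma pivot_self: "vec_nth (A e) i \<noteq> 0 \<Longrightarrow> pivot A e i (A e) = 0"
  by (simp add: pivot_def)

lemma lincomb_pivot: "lincomb (\<lambda>g. pivot A e i (A g)) X c = pivot A e i (lincomb A X c)"
  by (simp add: lincomb_def linear_sum[OF linear_pivot] linear_scale[OF linear_pivot])

text \<open>The kernel of the projection is the line through \<open>A e\<close>, so independence
  after projecting means independence together with \<open>e\<close>.\<close>

lemma indep_family_pivot:
  assumes "finite X" "e \<notin> X" "vec_nth (A e) i \<noteq> 0"
  shows "indep_family (\<lambda>g. pivot A e i (A g)) X \<longleftrightarrow> indep_family A (insert e X)"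
proof
  have Ae: "A e \<noteq> 0" using assms(3) by auto
  assume ind: "indep_family (\<lambda>g. pivot A e i (A g)) X"
  show "indep_family A (insert e X)"
    unfolding indep_family_def
  proof (intro allI impI)
    fix c assume "lincomb A (insert e X) c = 0"
    then have c: "c e *\<^sub>R A e + lincomb A X c = 0" by (simp add: lincomb_insert[OF assms(1,2)])
    then have "pivot A e i (c e *\<^sub>R A e + lincomb A X c) = 0"
      by (simp add: linear_0[OF linear_pivot])
    then have "pivot A e i (lincomb A X c) = 0"
      by (simp add: linear_add[OF linear_pivot] linear_scale[OF linear_pivot] pivot_self[of A e i, OF assms(3)])
    then have X: "\<forall>g\<in>X. c g = 0" using ind unfolding indep_family_def lincomb_pivot by blast
    then have "lincomb A X c = 0" by (simp add: lincomb_def)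
    then have "c e = 0" using c Ae by simp
    then show "\<forall>g\<in>insert e X. c g = 0" using X by simp
  qed
next
  assume ind: "indep_family A (insert e X)"
  show "indep_family (\<lambda>g. pivot A e i (A g)) X"
    unfolding indep_family_def lincomb_pivot
  proof (intro allI impI ballI)
    fix c g assume c: "pivot A e i (lincomb A X c) = 0" and g: "g \<in> X"
    define c' where "c' = c(e := - (vec_nth (lincomb A X c) i / vec_nth (A e) i))"
    have "lincomb A X c' = lincomb A X c"
      by (rule lincomb_cong) (use assms(2) in \<open>auto simp: c'_def\<close>)
    then have "lincomb A (insert e X) c' = 0"
      using c by (simp add: lincomb_insert[OF assms(1,2)] c'_def pivot_def)
    from indep_familyD[OF ind this, of g] have "c' g = 0" using g by simp
    moreover have "g \<noteq> e" using g assms(2) by auto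
    ultimately show "c g = 0" by (simp add: c'_def)
  qed
qed

text \<open>The minor of the pivoted matrix is the Schur complement of the bordered minor that has
  row \<open>i\<close> and column \<open>e\<close> in front. The matrix \<open>U\<close> below is
  the column operation clearing row \<open>i\<close>.\<close>

lemma det_submatrix_pivot:
  fixes A :: "'a \<Rightarrow> real ^ 'm"
  assumes "vec_nth (A e) i \<noteq> 0"
  shows "Determinant.det (submatrix A (Suc k) (case_nat i r) (case_nat e c)) =
    vec_nth (A e) i * Determinant.det (submatrix (\<lambda>g. pivot A e i (A g)) k r c)"
proof -
  define a where "a = vec_nth (A e) i"
  define M1 where "M1 = Matrix.mat 1 1 (\<lambda>_. a)"
  define M2 where "M2 = Matrix.mat 1 k (\<lambda>(_, l). vec_nth (A (c l)) i)"
  define M3 where "M3 = Matrix.mat k 1 (\<lambda>(j, _). vec_nth (A e) (r j))"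
  define M4 where "M4 = submatrix A k r c"
  define U2 where "U2 = Matrix.mat 1 k (\<lambda>(_, l). - vec_nth (A (c l)) i / a)"
  define U where "U = four_block_mat (1\<^sub>m 1) U2 (0\<^sub>m k 1) (1\<^sub>m k)"
  define M where "M = submatrix A (Suc k) (case_nat i r) (case_nat e c)"
  define N where "N = submatrix (\<lambda>g. pivot A e i (A g)) k r c"
  have dims: "M1 \<in> carrier_mat 1 1" "M2 \<in> carrier_mat 1 k" "M3 \<in> carrier_mat k 1" "M4 \<in> carrier_mat k k"
    "U2 \<in> carrier_mat 1 k" "N \<in> carrier_mat k k"
    by (auto simp: M1_def M2_def M3_def M4_def U2_def N_def)
  have M: "M = four_block_mat M1 M2 M3 M4"
    by (rule eq_matI) (auto simp: M_def M1_def M2_def M3_def M4_def a_def split: nat.splits)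
  have detU: "Determinant.det U = 1"
    unfolding U_def using dims
    by (subst det_four_block_mat_lower_left_zero[of _ 1 _ k]) auto
  have "M * U = four_block_mat (M1 * 1\<^sub>m 1 + M2 * 0\<^sub>m k 1) (M1 * U2 + M2 * 1\<^sub>m k)
      (M3 * 1\<^sub>m 1 + M4 * 0\<^sub>m k 1) (M3 * U2 + M4 * 1\<^sub>m k)"
    unfolding M U_def by (rule mult_four_block_mat) (use dims in auto)
  also have "M1 * 1\<^sub>m 1 + M2 * 0\<^sub>m k 1 = M1" using dims by simp
  also have "M1 * U2 + M2 * 1\<^sub>m k = 0\<^sub>m 1 k"
    using dims assms by (intro eq_matI) (auto simp: M1_def M2_def U2_def a_def scalar_prod_def)
  also have "M3 * 1\<^sub>m 1 + M4 * 0\<^sub>m k 1 = M3" using dims by simp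
  also have "M3 * U2 + M4 * 1\<^sub>m k = N"
    using dims by (intro eq_matI)
      (auto simp: M3_def M4_def U2_def N_def a_def pivot_def scalar_prod_def)
  finally have "Determinant.det (M * U) = Determinant.det M1 * Determinant.det N"
    using det_four_block_mat_upper_right_zero[OF dims(1) refl dims(3,6)] by simp
  moreover have "Determinant.det (M * U) = Determinant.det M * Determinant.det U"
    by (rule det_mult[of _ "Suc k"]) (use dims in \<open>auto simp: M_def U_def\<close>)
  moreover have "Determinant.det M1 = a" using det_single[OF dims(1)] by (simp add: M1_def)
  ultimately show ?thesis using detU by (simp add: M_def N_def a_def)
qed

lemma totally_unimodular_pivot:
  fixes A :: "'a \<Rightarrow> real ^ 'm"
  assumes "totally_unimodular E A" "e \<in> E" "vec_nth (A e) i \<noteq> 0"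
  shows "totally_unimodular (E - {e}) (\<lambda>g. pivot A e i (A g))"
  unfolding totally_unimodular_def
proof (intro allI impI, elim conjE)
  fix k and r :: "nat \<Rightarrow> 'm" and c
  assume r: "inj_on r {..<k}" and c: "inj_on c {..<k}" "c ` {..<k} \<subseteq> E - {e}"
  let ?N = "submatrix (\<lambda>g. pivot A e i (A g)) k r c"
  show "Determinant.det ?N \<in> {-1, 0, 1}"
  proof (cases "i \<in> r ` {..<k}")
    case True
    then obtain j where j: "j < k" "r j = i" by auto
    \<comment> \<open>Row \<open>i\<close> of the pivoted matrix is zero, so every Leibniz term has
      a zero factor.\<close>
    have "(\<Prod>l = 0..<k. ?N $$ (l, p l)) = 0" if "p permutes {0..<k}" for p
    proof (rule prod_zero)
      have "p j < k" using permutes_in_image[OF that, of j] j by auto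
      then have "?N $$ (j, p j) = 0" using j assms(3) by (simp add: pivot_def)
      then show "\<exists>l\<in>{0..<k}. ?N $$ (l, p l) = 0" using j by (intro bexI[of _ j]) auto
    qed simp
    then have "Determinant.det ?N = 0" by (subst det_def'[of _ k]) (auto intro!: sum.neutral)
    then show ?thesis by simp
  next
    case False
    have "Determinant.det (submatrix A (Suc k) (case_nat i r) (case_nat e c)) \<in> {-1, 0, 1}"
    proof (rule totally_unimodularD[OF assms(1)])
      show "inj_on (case_nat i r) {..<Suc k}"
        using r False by (auto simp: inj_on_def split: nat.splits)
      show "inj_on (case_nat e c) {..<Suc k}"
        using c by (auto simp: inj_on_def split: nat.splits)
      show "case_nat e c ` {..<Suc k} \<subseteq> E"
        using c(2) assms(2) by (auto simp: image_subset_iff split: nat.splits)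
    qed
    moreover have "vec_nth (A e) i \<in> {-1, 1}"
      using totally_unimodular_entry[OF assms(1,2), of i] assms(3) by auto
    ultimately show ?thesis unfolding det_submatrix_pivot[of A, OF assms(3)] by auto
  qed
qed

section \<open>Balls under contraction\<close>

lemma int_ball_pivot_subset:
  assumes "finite E" "vec_nth (A e) i \<noteq> 0" "x \<in> int_ball A E m"
  shows "pivot A e i x \<in> int_ball (\<lambda>g. pivot A e i (A g)) (E - {e}) m"
proof -
  obtain c where c: "x = lincomb A E (\<lambda>g. real_of_int (c g))" "(\<Sum>g\<in>E. \<bar>c g\<bar>) \<le> int m"
    using assms(3) by (rule int_ballE)
  have "lincomb (\<lambda>g. pivot A e i (A g)) E d = lincomb (\<lambda>g. pivot A e i (A g)) (E - {e}) d" for d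
    unfolding lincomb_def
    by (rule sum.mono_neutral_right) (use assms(1) pivot_self[of A e i, OF assms(2)] in auto)
  then have "pivot A e i x = lincomb (\<lambda>g. pivot A e i (A g)) (E - {e}) (\<lambda>g. real_of_int (c g))"
    unfolding c(1) lincomb_pivot[symmetric] by simp
  moreover have "(\<Sum>g\<in>E - {e}. \<bar>c g\<bar>) \<le> int m"
  proof -
    have "(\<Sum>g\<in>E - {e}. \<bar>c g\<bar>) \<le> (\<Sum>g\<in>E. \<bar>c g\<bar>)" by (rule sum_mono2) (use assms(1) in auto)
    then show ?thesis using c(2) by simp
  qed
  ultimately show ?thesis using int_ballI[of c "E - {e}" m "\<lambda>g. pivot A e i (A g)"] by simp
qed

text \<open>Coefficient 0 at \<open>e\<close> lifts a combination without raising its norm: the word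
  length of a coset is the minimum over the coset.\<close>

lemma int_ball_pivot_lift:
  assumes "finite E" "y \<in> int_ball (\<lambda>g. pivot A e i (A g)) (E - {e}) m"
  shows "\<exists>x \<in> int_ball A E m. pivot A e i x = y"
proof -
  obtain c where c: "y = lincomb (\<lambda>g. pivot A e i (A g)) (E - {e}) (\<lambda>g. real_of_int (c g))"
    "(\<Sum>g\<in>E - {e}. \<bar>c g\<bar>) \<le> int m"
    using assms(2) by (rule int_ballE)
  define c' where "c' g = (if g \<in> E - {e} then c g else 0)" for g
  have "lincomb A E (\<lambda>g. real_of_int (c' g)) = lincomb A E (\<lambda>g. if g \<in> E - {e} then real_of_int (c g) else 0)"
    by (rule lincomb_cong) (simp add: c'_def)
  also have "\<dots> = lincomb A (E - {e}) (\<lambda>g. real_of_int (c g))"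
    by (rule lincomb_extend) (use assms in auto)
  finally have "pivot A e i (lincomb A E (\<lambda>g. real_of_int (c' g))) = y"
    unfolding c(1) lincomb_pivot by simp
  moreover have "(\<Sum>g\<in>E. \<bar>c' g\<bar>) = (\<Sum>g\<in>E - {e}. \<bar>c g\<bar>)"
    by (rule sum.mono_neutral_cong_right) (use assms(1) in \<open>auto simp: c'_def\<close>)
  ultimately show ?thesis using c(2) int_ballI[of c' E m A] by auto
qed

text \<open>Convexity of the word length on a line: a real convex combination of the two coefficient
  vectors stays within norm \<open>m\<close> and represents an integral point, so integer
  coefficients of norm at most \<open>m\<close> exist too.\<close>

lemma int_ball_between:
  fixes A :: "'a \<Rightarrow> real ^ 'm"
  assumes tu: "totally_unimodular E A" and fin: "finite E" and e: "e \<in> E"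
    and x: "x \<in> int_ball A E m" and y: "x + real (Suc k) *\<^sub>R A e \<in> int_ball A E m"
  shows "x + A e \<in> int_ball A E m"
proof -
  obtain c where c: "x = lincomb A E (\<lambda>g. real_of_int (c g))" "(\<Sum>g\<in>E. \<bar>c g\<bar>) \<le> int m"
    using x by (rule int_ballE)
  obtain d where d: "x + real (Suc k) *\<^sub>R A e = lincomb A E (\<lambda>g. real_of_int (d g))" "(\<Sum>g\<in>E. \<bar>d g\<bar>) \<le> int m"
    using y by (rule int_ballE)
  define t where "t = 1 / real (Suc k)"
  have t: "0 \<le> t" "t \<le> 1" "t * real (Suc k) = 1" by (auto simp: t_def)
  define a where "a = (\<lambda>g. (1 - t) * real_of_int (c g) + t * real_of_int (d g))"
  have "lincomb A E a = (1 - t) *\<^sub>R x + t *\<^sub>R (x + real (Suc k) *\<^sub>R A e)"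
    unfolding a_def lincomb_add lincomb_scale c(1)[symmetric] d(1)[symmetric] ..
  also have "\<dots> = x + (t * real (Suc k)) *\<^sub>R A e"
    by (simp add: scaleR_right_distrib scaleR_left_diff_distrib)
  also have "\<dots> = x + A e" unfolding t(3) by simp
  finally have a: "lincomb A E a = x + A e" .
  have rc: "(\<Sum>g\<in>E. \<bar>real_of_int (c g)\<bar>) \<le> real m" "(\<Sum>g\<in>E. \<bar>real_of_int (d g)\<bar>) \<le> real m"
    using c(2) d(2) by (simp_all flip: of_int_abs of_int_sum)
  have "(\<Sum>g\<in>E. \<bar>a g\<bar>) \<le> (1 - t) * real m + t * real m"
    using sum_abs_combination_le[of "1 - t" "\<lambda>g. real_of_int (c g)" t "\<lambda>g. real_of_int (d g)" E]
      mult_left_mono[OF rc(1), of "1 - t"] mult_left_mono[OF rc(2) t(1)] t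
    by (simp add: a_def)
  then have "(\<Sum>g\<in>E. \<bar>a g\<bar>) \<le> real m" by (simp add: algebra_simps)
  moreover have "vec_nth (lincomb A E a) j \<in> \<int>" for j
  proof -
    have "vec_nth (A e) j \<in> \<int>"
      using totally_unimodular_entry[OF tu e, of j] by (elim insertE) simp_all
    then show ?thesis unfolding a using int_ball_integral[OF tu x, of j] by simp
  qed
  ultimately show ?thesis using totally_unimodular_rounding[OF tu fin, of a m] a by simp
qed

text \<open>A line in direction \<open>A e\<close> meets the ball in an interval or not at all. The
  set on the left consists of the upper endpoints, one for each coset that meets the ball.\<close>

lemma card_int_ball_pivot:
  fixes A :: "'a \<Rightarrow> real ^ 'm"
  assumes tu: "totally_unimodular E A" and fin: "finite E" and e: "e \<in> E" and i: "vec_nth (A e) i \<noteq> 0"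
  shows "card {x \<in> int_ball A E m. x + A e \<notin> int_ball A E m} =
    card (int_ball (\<lambda>g. pivot A e i (A g)) (E - {e}) m)"
proof (rule bij_betw_same_card[of "pivot A e i"])
  let ?U = "{x \<in> int_ball A E m. x + A e \<notin> int_ball A E m}"
  let ?B = "int_ball (\<lambda>g. pivot A e i (A g)) (E - {e}) m"
  have ai: "vec_nth (A e) i \<in> {-1, 1}"
    using totally_unimodular_entry[OF tu e, of i] i by auto
  have Ae: "A e \<noteq> 0" using i by auto
  have below: "\<not> (z = real (Suc k))" if "x \<in> ?U" "x + z *\<^sub>R A e \<in> ?U" for x z k
    using int_ball_between[OF tu fin e, of x m k] that by auto
  show "bij_betw (pivot A e i) ?U ?B"
    unfolding bij_betw_def
  proof
    show "inj_on (pivot A e i) ?U"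
    proof (rule inj_onI)
      fix x y assume xy: "x \<in> ?U" "y \<in> ?U" "pivot A e i x = pivot A e i y"
      \<comment> \<open>Equal projections differ by a multiple of \<open>A e\<close>; it is an
        integer multiple because the pivot entry is \<plusminus>1.\<close>
      define t where "t = (vec_nth y i - vec_nth x i) / vec_nth (A e) i"
      have y: "y = x + t *\<^sub>R A e" and x: "x = y + (- t) *\<^sub>R A e"
        using xy(3) by (simp_all add: pivot_def t_def diff_divide_distrib algebra_simps)
      have "vec_nth x i \<in> \<int>" "vec_nth y i \<in> \<int>"
        using int_ball_integral[OF tu, of _ m i] xy(1,2) by auto
      then have "t \<in> \<int>" using ai by (auto simp: t_def intro: Ints_diff)
      then obtain k where k: "t = real_of_int k" by (rule Ints_cases)
      consider "k = 0" | n where "t = real (Suc n)" | n where "- t = real (Suc n)"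
      proof -
        consider "k = 0" | "k > 0" | "k < 0" by linarith
        then show ?thesis
        proof cases
          case 2
          then have "t = real (Suc (nat (k - 1)))" by (simp add: k)
          then show ?thesis by (rule that(2))
        next
          case 3
          then have "- t = real (Suc (nat (- k - 1)))" by (simp add: k)
          then show ?thesis by (rule that(3))
        qed (rule that(1))
      qed
      then show "x = y"
      proof cases
        case 1
        then show ?thesis using y k by simp
      next
        case (2 n)
        then show ?thesis using below[OF xy(1), of t n] xy(2) y by simp
      next
        case (3 n)
        then show ?thesis using below[OF xy(2), of "- t" n] xy(1) x by simp
      qed
    qed
    show "pivot A e i ` ?U = ?B"
    proof (intro subset_antisym subsetI)
      fix y assume "y \<in> pivot A e i ` ?U"
      then show "y \<in> ?B" using int_ball_pivot_subset[of E A e i, OF fin i] by blast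
    next
      fix y assume "y \<in> ?B"
      then obtain x where x: "x \<in> int_ball A E m" "pivot A e i x = y"
        using int_ball_pivot_lift[OF fin, of y A e i m] by blast
      define K where "K = {k :: nat. x + real k *\<^sub>R A e \<in> int_ball A E m}"
      have "finite ((\<lambda>k :: nat. x + real k *\<^sub>R A e) ` K)"
        by (rule finite_subset[OF _ finite_int_ball[OF fin, of A m]]) (auto simp: K_def)
      moreover have "inj_on (\<lambda>k :: nat. x + real k *\<^sub>R A e) K"
        using Ae by (auto simp: inj_on_def)
      ultimately have finK: "finite K" by (rule finite_imageD)
      have "0 \<in> K" using x by (simp add: K_def)
      then have "Max K \<in> K" using finK by (intro Max_in) auto
      moreover have "Suc (Max K) \<notin> K" using Max_ge[OF finK, of "Suc (Max K)"] by (meson Suc_n_not_le_n)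
      moreover have "x + real (Suc (Max K)) *\<^sub>R A e = x + real (Max K) *\<^sub>R A e + A e"
        by (simp add: scaleR_left_distrib)
      ultimately have "x + real (Max K) *\<^sub>R A e \<in> ?U" unfolding K_def mem_Collect_eq by metis
      moreover have "pivot A e i (x + real (Max K) *\<^sub>R A e) = y"
        using x(2) by (simp add: linear_add[OF linear_pivot] linear_scale[OF linear_pivot]
          pivot_self[of A e i, OF i])
      ultimately show "y \<in> pivot A e i ` ?U" by blast
    qed
  qed
qed

text \<open>By convexity and parity, the word length on a line \<open>x + \<int> A e\<close> has the form
  \<open>k \<mapsto> l + \<bar>k - k\<^sub>0\<bar>\<close>, so each sphere meets it in one point of slope \<open>+1\<close> if \<open>l \<le> n + 1\<close> and
  one of slope \<open>-1\<close> if \<open>l \<le> n\<close>.\<close>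

lemma card_int_ball_Suc:
  fixes A :: "'a \<Rightarrow> real ^ 'm"
  assumes tu: "totally_unimodular E A" and fin: "finite E" and e: "e \<in> E" and i: "vec_nth (A e) i \<noteq> 0"
    and parity: "\<And>z :: 'a \<Rightarrow> int. lincomb A E (\<lambda>g. real_of_int (z g)) = 0 \<Longrightarrow> even (\<Sum>g\<in>E. z g)"
  shows "card (int_ball A E (Suc n)) = card (int_ball A E n) +
    card (int_ball (\<lambda>g. pivot A e i (A g)) (E - {e}) (Suc n)) +
    card (int_ball (\<lambda>g. pivot A e i (A g)) (E - {e}) n)"
proof -
  define ball where "ball = int_ball A E"
  define up where "up m = {x \<in> ball m. x + A e \<notin> ball m}" for m
  \<comment> \<open>The points just below the ball of radius \<open>n\<close> on their lines. They
    are reflections of its upper endpoints, because the ball is symmetric, and so they are equally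
    many.\<close>
  define down where "down = (\<lambda>x. - x - A e) ` up n"
  have finb: "finite (ball m)" for m unfolding ball_def by (rule finite_int_ball[OF fin])
  have mono: "ball n \<subseteq> ball (Suc n)" unfolding ball_def by (rule int_ball_mono) simp
  have neg: "- x \<in> ball m \<longleftrightarrow> x \<in> ball m" for x m
    unfolding ball_def using uminus_in_int_ball[of x A E m] uminus_in_int_ball[of "- x" A E m] by auto
  have plus: "x + A e \<in> ball (Suc m)" and minus: "x - A e \<in> ball (Suc m)" if "x \<in> ball m" for x m
    using int_ball_translate[OF fin e, of x A m 1] int_ball_translate[OF fin e, of x A m "-1"] that
    by (simp_all add: ball_def)
  \<comment> \<open>The parity step: neighbours on a line cannot both have length
    \<open>n + 1\<close>.\<close>
  have sphere: "x + A e \<in> ball n" if x: "x \<in> ball (Suc n)" "x \<notin> ball n" "x + A e \<in> ball (Suc n)" for x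
  proof (rule ccontr)
    assume xe: "x + A e \<notin> ball n"
    obtain c where c: "x = lincomb A E (\<lambda>g. real_of_int (c g))" "(\<Sum>g\<in>E. \<bar>c g\<bar>) \<le> int (Suc n)"
      using x(1) unfolding ball_def by (rule int_ballE)
    obtain d where d: "x + A e = lincomb A E (\<lambda>g. real_of_int (d g))" "(\<Sum>g\<in>E. \<bar>d g\<bar>) \<le> int (Suc n)"
      using x(3) unfolding ball_def by (rule int_ballE)
    have "\<not> (\<Sum>g\<in>E. \<bar>c g\<bar>) \<le> int n" using x(2) c(1) int_ballI[of c E n A] by (auto simp: ball_def)
    then have c': "(\<Sum>g\<in>E. \<bar>c g\<bar>) = int (Suc n)" using c(2) by simp
    have "\<not> (\<Sum>g\<in>E. \<bar>d g\<bar>) \<le> int n" using xe d(1) int_ballI[of d E n A] by (auto simp: ball_def)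
    then have d': "(\<Sum>g\<in>E. \<bar>d g\<bar>) = int (Suc n)" using d(2) by simp
    \<comment> \<open>A coefficient vector has norm and coefficient sum of the same parity.\<close>
    have par: "even ((\<Sum>g\<in>E. \<bar>f g\<bar>) - (\<Sum>g\<in>E. f g))" for f :: "'a \<Rightarrow> int"
      unfolding sum_subtractf[symmetric] by (rule dvd_sum) (auto simp: abs_if)
    \<comment> \<open>The relation obtained from the two words and the step \<open>e\<close>; equal
      norms would make its coefficient sum odd.\<close>
    define z where "z g = d g - c g - (if g = e then 1 else 0)" for g
    have "lincomb A E (\<lambda>g. real_of_int (z g)) =
      lincomb A E (\<lambda>g. real_of_int (d g) - real_of_int (c g) - (if g = e then 1 else 0))"
      by (rule lincomb_cong) (simp add: z_def)
    also have "\<dots> = 0"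
      unfolding lincomb_diff lincomb_single[OF fin e] c(1)[symmetric] d(1)[symmetric] by simp
    finally have "even (\<Sum>g\<in>E. z g)" by (rule parity)
    moreover have "(\<Sum>g\<in>E. z g) = (\<Sum>g\<in>E. d g) - (\<Sum>g\<in>E. c g) - 1"
      using fin e by (simp add: z_def sum_subtractf)
    moreover have "even ((\<Sum>g\<in>E. d g) - (\<Sum>g\<in>E. c g))"
      using dvd_diff[OF par[of c] par[of d]] unfolding c' d' by simp
    ultimately show False by simp
  qed
  have ball_Suc: "ball (Suc n) = ball n \<union> (up (Suc n) \<union> down)"
  proof (intro subset_antisym subsetI)
    fix x assume x: "x \<in> ball (Suc n)"
    show "x \<in> ball n \<union> (up (Suc n) \<union> down)"
    proof (cases "x \<in> ball n \<or> x + A e \<notin> ball (Suc n)")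
      case True
      then show ?thesis using x by (auto simp: up_def)
    next
      case False
      then have "x + A e \<in> ball n" using sphere x by blast
      then have "- x - A e \<in> ball n" using neg[of "x + A e" n] by simp
      moreover have "- x - A e + A e \<notin> ball n" using False neg[of x n] by simp
      ultimately have "- x - A e \<in> up n" unfolding up_def by blast
      then have "- (- x - A e) - A e \<in> down" unfolding down_def by (rule imageI)
      then show ?thesis by simp
    qed
  next
    fix x assume "x \<in> ball n \<union> (up (Suc n) \<union> down)"
    moreover have "x \<in> ball (Suc n)" if "x \<in> down"
    proof -
      obtain y where y: "y \<in> ball n" "x = - y - A e" using \<open>x \<in> down\<close> by (auto simp: down_def up_def)
      then have "- y \<in> ball n" using neg[of y n] by simp
      then show ?thesis unfolding y(2) by (rule minus)
    qed
    ultimately show "x \<in> ball (Suc n)" using mono by (auto simp: up_def)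
  qed
  have down: "x \<notin> ball n" "x + A e \<in> ball n" if x: "x \<in> down" for x
  proof -
    obtain y where y: "y \<in> ball n" "y + A e \<notin> ball n" "x = - y - A e"
      using x by (auto simp: down_def up_def)
    show "x \<notin> ball n" using y(2,3) neg[of "y + A e" n] by simp
    show "x + A e \<in> ball n" using y(1,3) neg[of y n] by simp
  qed
  \<comment> \<open>From a point of the smaller ball one step stays in the larger one, so no such
    point is an upper endpoint of the larger ball.\<close>
  have "ball n \<inter> (up (Suc n) \<union> down) = {}"
    using plus down(1) by (auto simp: up_def)
  moreover have "up (Suc n) \<inter> down = {}"
    using down(2) mono by (auto simp: up_def)
  moreover have "finite (up m)" for m using finb by (simp add: up_def)
  moreover have "finite down" unfolding down_def using \<open>finite (up n)\<close> by simp
  ultimately have "card (ball (Suc n)) = card (ball n) + (card (up (Suc n)) + card down)"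
    unfolding ball_Suc using finb by (simp add: card_Un_disjoint)
  moreover have "card down = card (up n)"
    unfolding down_def by (rule card_image) (simp add: inj_on_def)
  moreover have "card (up m) = card (int_ball (\<lambda>g. pivot A e i (A g)) (E - {e}) m)" for m
    unfolding up_def ball_def by (rule card_int_ball_pivot[OF tu fin e i])
  ultimately show ?thesis by (simp add: ball_def)
qed

section \<open>Circuits, parity of relations and rank of a contraction\<close>

lemma vector_matroid_indep_iff:
  assumes "finite E"
  shows "vector_matroid_indep E A X \<longleftrightarrow> X \<subseteq> E \<and> indep_family A X"
  using assms indep_family_iff[of X A] finite_subset[of X E]
  unfolding vector_matroid_indep_def by blast

lemma contract_indep_iff: "contract_indep indep e X \<longleftrightarrow> e \<notin> X \<and> indep (insert e X)"
proof
  assume "contract_indep indep e X"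
  then obtain I where "e \<in> I" "indep I" "X = I - {e}" unfolding contract_indep_def by blast
  then show "e \<notin> X \<and> indep (insert e X)" by (simp add: insert_absorb)
next
  assume "e \<notin> X \<and> indep (insert e X)"
  then show "contract_indep indep e X"
    unfolding contract_indep_def by (intro exI[of _ "insert e X"]) auto
qed

text \<open>Removing an element \<open>b\<close> of the support leaves an independent set by
  exchange, hence minimality. For empty \<open>X\<close> the circuit is a loop.\<close>

lemma fundamental_circuit:
  assumes "finite E" "\<And>X. indep X \<longleftrightarrow> X \<subseteq> E \<and> indep_family A X"
    and "X \<subseteq> E" "indep_family A X" "g \<in> E" "g \<notin> X" "A g = lincomb A X c"
  shows "circuit E indep (insert g {b \<in> X. c b \<noteq> 0})"
proof -
  define S where "S = {b \<in> X. c b \<noteq> 0}"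
  have fin: "finite X" "finite S" "S \<subseteq> X" using assms(1,3) by (auto simp: S_def intro: finite_subset)
  have gS: "g \<notin> S" using assms(6) by (simp add: S_def)
  have indS: "indep_family A S" by (rule indep_family_subset[OF assms(4) fin(3,1)])
  have "A g = lincomb A S c"
    unfolding assms(7) by (rule lincomb_mono_neutral) (use fin in \<open>auto simp: S_def\<close>)
  then have "A g \<in> span (A ` S)" using lincomb_in_span[of S S A c] by simp
  then have dep: "\<not> indep_family A (insert g S)"
    using indep_family_insert[OF fin(2) indS gS] by simp
  have "indep D" if D: "D \<subset> insert g S" for D
  proof (cases "g \<in> D")
    case False
    then have "D \<subseteq> X" using D fin(3) by blast
    then show ?thesis
      unfolding assms(2) using assms(3) indep_family_subset[OF assms(4) _ fin(1)] by auto
  next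
    case True
    then obtain b where b: "b \<in> S" "b \<notin> D" using D by blast
    have "indep_family A (insert g (X - {b}))"
      using lincomb_exchange[OF fin(1) assms(6) _ assms(4,7), of b] b by (simp add: S_def)
    moreover have sub: "D \<subseteq> insert g (X - {b})" using D b fin(3) by blast
    ultimately have "indep_family A D" using indep_family_subset[of A _ D] fin(1) by simp
    then show ?thesis unfolding assms(2) using sub assms(3,5) by blast
  qed
  then show ?thesis
    unfolding circuit_def S_def[symmetric] using dep assms(2,3,5) fin(3) by blast
qed

text \<open>Every relation is the combination of the fundamental relations of a basis
  \<open>X\<close>, weighted by its coefficients outside \<open>X\<close>. A fundamental relation
  has coefficients \<plusminus>1 exactly on a circuit, so its sum is even.\<close>

lemma even_sum_of_kernel:
  fixes A :: "'a \<Rightarrow> real ^ 'm" and z :: "'a \<Rightarrow> int"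
  assumes fin: "finite E" and uni: "unimodular_family A E"
    and ind: "\<And>X. indep X \<longleftrightarrow> X \<subseteq> E \<and> indep_family A X"
    and bip: "bipartite_matroid E indep"
    and ker: "lincomb A E (\<lambda>g. real_of_int (z g)) = 0"
  shows "even (\<Sum>g\<in>E. z g)"
proof -
  obtain X where X: "X \<subseteq> E" "indep_family A X" "A ` E \<subseteq> span (A ` X)"
    using exists_basis[OF fin] by blast
  have finX: "finite X" using X(1) fin by (rule finite_subset)
  define Y where "Y = E - X"
  have finY: "finite Y" using fin by (simp add: Y_def)
  have "\<exists>c. A g = lincomb A X (\<lambda>b. real_of_int (c b)) \<and> (\<forall>b\<in>X. c b \<in> {-1, 0, 1})" if "g \<in> E" for g
  proof -
    have "A g \<in> range (lincomb A X)"
      using X(3) that span_image_eq_range_lincomb[OF finX, of A] by auto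
    then obtain c where c: "A g = lincomb A X c" by (rule rangeE)
    have c01: "c b \<in> {-1, 0, 1}" if "b \<in> X" for b
      by (rule unimodular_familyD[OF uni X(1,2) \<open>g \<in> E\<close> c that])
    have "\<exists>k \<in> {-1, 0, 1}. c b = real_of_int k" if "b \<in> X" for b
      using c01[OF that] by auto
    then have floor: "real_of_int \<lfloor>c b\<rfloor> = c b" "\<lfloor>c b\<rfloor> \<in> {-1, 0, 1}" if "b \<in> X" for b
      using that by (metis floor_of_int)+
    have "A g = lincomb A X (\<lambda>b. real_of_int \<lfloor>c b\<rfloor>)"
      unfolding c by (rule lincomb_cong) (simp add: floor(1))
    then show ?thesis using floor(2) by (intro exI[of _ "\<lambda>b. \<lfloor>c b\<rfloor>"] conjI ballI)
  qed
  then obtain c where c: "\<And>g. g \<in> E \<Longrightarrow> A g = lincomb A X (\<lambda>b. real_of_int (c g b))"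
    "\<And>g b. g \<in> E \<Longrightarrow> b \<in> X \<Longrightarrow> c g b \<in> {-1, 0, 1 :: int}" by metis
  \<comment> \<open>This is the coefficient sum of the fundamental relation of \<open>g\<close>: 1
    at \<open>g\<close> and \<open>- c g b\<close> at each \<open>b\<close> in the basis.\<close>
  have even1: "even (1 - (\<Sum>b\<in>X. c g b))" if "g \<in> Y" for g
  proof -
    have g: "g \<in> E" "g \<notin> X" using that by (auto simp: Y_def)
    have "circuit E indep (insert g {b \<in> X. real_of_int (c g b) \<noteq> 0})"
      by (rule fundamental_circuit[OF fin ind X(1,2) g c(1)[OF g(1)]])
    then have "even (card (insert g {b \<in> X. c g b \<noteq> 0}))"
      using bip unfolding bipartite_matroid_def by simp
    then have ev: "even (Suc (card {b \<in> X. c g b \<noteq> 0}))" using finX g by simp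
    have "int (card {b \<in> X. c g b \<noteq> 0}) = (\<Sum>b\<in>X. if c g b \<noteq> 0 then 1 else 0)"
      using finX by (simp add: sum.If_cases Int_def)
    also have "\<dots> = (\<Sum>b\<in>X. \<bar>c g b\<bar>)"
      by (rule sum.cong) (use c(2)[OF g(1)] in fastforce)+
    finally have "int (card {b \<in> X. c g b \<noteq> 0}) = (\<Sum>b\<in>X. \<bar>c g b\<bar>)" .
    moreover have "even ((\<Sum>b\<in>X. \<bar>c g b\<bar>) - (\<Sum>b\<in>X. c g b))"
      unfolding sum_subtractf[symmetric] by (rule dvd_sum) (auto simp: abs_if)
    ultimately show ?thesis using ev by presburger
  qed
  have E: "E = X \<union> Y" "X \<inter> Y = {}" using X(1) by (auto simp: Y_def)
  have split: "lincomb A E f = lincomb A X f + lincomb A Y f" for f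
    unfolding lincomb_def E(1) by (rule sum.union_disjoint[OF finX finY E(2)])
  have "lincomb A Y f = lincomb A X (\<lambda>b. \<Sum>g\<in>Y. f g * real_of_int (c g b))" for f
  proof -
    have "lincomb A Y f = (\<Sum>g\<in>Y. f g *\<^sub>R lincomb A X (\<lambda>b. real_of_int (c g b)))"
      unfolding lincomb_def[of A Y] by (rule sum.cong) (use c(1) in \<open>auto simp: Y_def\<close>)
    also have "\<dots> = (\<Sum>b\<in>X. \<Sum>g\<in>Y. (f g * real_of_int (c g b)) *\<^sub>R A b)"
      unfolding lincomb_def scaleR_sum_right by (subst sum.swap) simp
    finally show ?thesis by (simp add: lincomb_def scaleR_sum_left)
  qed
  then have "lincomb A X (\<lambda>b. real_of_int (z b + (\<Sum>g\<in>Y. z g * c g b))) = 0"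
    using ker split[of "\<lambda>g. real_of_int (z g)"] by (simp flip: lincomb_add)
  from indep_familyD[OF X(2) this] have zb: "z b = - (\<Sum>g\<in>Y. z g * c g b)" if "b \<in> X" for b
    using that by (metis add_eq_0_iff2 of_int_eq_0_iff)
  have "(\<Sum>g\<in>E. z g) = (\<Sum>b\<in>X. z b) + (\<Sum>g\<in>Y. z g)"
    unfolding E(1) by (rule sum.union_disjoint[OF finX finY E(2)])
  also have "(\<Sum>b\<in>X. z b) = - (\<Sum>g\<in>Y. z g * (\<Sum>b\<in>X. c g b))"
    unfolding sum_distrib_left by (subst sum.swap) (simp add: zb sum_negf)
  also have "\<dots> + (\<Sum>g\<in>Y. z g) = (\<Sum>g\<in>Y. z g * (1 - (\<Sum>b\<in>X. c g b)))"
    by (simp add: algebra_simps sum_subtractf)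
  finally show ?thesis using even1 by (simp add: dvd_sum)
qed

text \<open>A basis of the contraction becomes a basis of \<open>E\<close> when \<open>e\<close> is
  added.\<close>

lemma dim_contraction:
  fixes A :: "'a \<Rightarrow> real ^ 'm" and B :: "'a \<Rightarrow> real ^ 'n"
  assumes "finite E" "e \<in> E"
    and ind: "\<And>X. X \<subseteq> E - {e} \<Longrightarrow> indep_family B X \<longleftrightarrow> indep_family A (insert e X)"
  shows "dim (A ` E) = Suc (dim (B ` (E - {e})))"
proof -
  have finE': "finite (E - {e})" using assms(1) by simp
  obtain Y where Y: "Y \<subseteq> E - {e}" "indep_family B Y" "B ` (E - {e}) \<subseteq> span (B ` Y)"
    using exists_basis[OF finE'] by blast
  have finY: "finite Y" and eY: "e \<notin> Y" using Y(1) assms(1) by (auto intro: finite_subset)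
  have indeY: "indep_family A (insert e Y)" using ind[OF Y(1)] Y(2) by simp
  have "A g \<in> span (A ` insert e Y)" if g: "g \<in> E" for g
  proof (cases "g \<in> insert e Y")
    case True
    then show ?thesis by (intro span_base imageI)
  next
    case False
    show ?thesis
    proof (rule ccontr)
      assume "A g \<notin> span (A ` insert e Y)"
      then have "indep_family A (insert g (insert e Y))"
        using indep_family_insert[OF _ indeY False] finY by simp
      then have "indep_family B (insert g Y)"
        using ind[of "insert g Y"] Y(1) g False by (simp add: insert_commute)
      then have "B g \<notin> span (B ` Y)" using indep_family_insert[OF finY Y(2), of g] False by simp
      then show False using Y(3) g False by blast
    qed
  qed
  then have "dim (A ` E) = card (insert e Y)"
    using Y(1) assms(2) by (intro dim_image_eq_card[OF assms(1) _ indeY]) auto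
  moreover have "dim (B ` (E - {e})) = card Y" by (rule dim_image_eq_card[OF finE' Y(1,2,3)])
  ultimately show ?thesis using finY eY by simp
qed

section \<open>From ball counts to the h*-polynomial\<close>

lemma hstar_symmetric_edge_polytope:
  fixes A :: "'a \<Rightarrow> real ^ 'm"
  assumes "totally_unimodular E A" "finite E"
  shows "hstar (symmetric_edge_polytope E A) =
    Abs_fps (\<lambda>m. int (card (int_ball A E m))) * (1 - fps_X) ^ (dim (A ` E) + 1)"
  by (simp add: hstar_def ehrhart_series_def aff_dim_symmetric_edge_polytope[OF assms(2)]
      lattice_point_count_eq_card_int_ball[OF assms])

text \<open>As the polytope of the contraction is determined only up to unimodular equivalence, the
  identity is stated for every representation \<open>B\<close>, with any number of rows. The
  existence part shows that the contraction is regular.\<close>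

theorem proposition3p4:
  fixes E :: "'a set" and indep :: "'a set \<Rightarrow> bool" and e :: 'a
    and A :: "'a \<Rightarrow> real ^ 'm"
  assumes "matroid E indep"
    and "regular_representation E indep A"
    and "bipartite_matroid E indep"
    and "e \<in> E"
  shows "(\<exists>B :: 'a \<Rightarrow> real ^ 'm.
            regular_representation (E - {e}) (contract_indep indep e) B) \<and>
         (\<forall>B :: 'a \<Rightarrow> real ^ 'n.
            regular_representation (E - {e}) (contract_indep indep e) B \<longrightarrow>
            hstar (symmetric_edge_polytope E A) =
              (1 + fps_X) * hstar (symmetric_edge_polytope (E - {e}) B))"
proof -
  have fin: "finite E" and finE': "finite (E - {e})" using matroid.finite_ground[OF assms(1)] by auto
  have tu: "totally_unimodular E A" using assms(2) by (simp add: regular_representation_def)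
  have ind: "indep X \<longleftrightarrow> X \<subseteq> E \<and> indep_family A X" for X
    using assms(2) vector_matroid_indep_iff[OF fin, of A X] by (simp add: regular_representation_def)
  have cind: "contract_indep indep e X \<longleftrightarrow> X \<subseteq> E - {e} \<and> indep_family A (insert e X)" for X
    unfolding contract_indep_iff ind using assms(4) by blast
  \<comment> \<open>A zero column would make \<open>{e}\<close> a circuit, of odd size 1.\<close>
  have "A e \<noteq> 0"
  proof
    assume "A e = 0"
    then have "circuit E indep (insert e {b \<in> {}. (0 :: real) \<noteq> 0})"
      using fundamental_circuit[OF fin ind, of "{}" e "\<lambda>_. 0"] assms(4)
      by (simp add: indep_family_empty lincomb_def)
    then show False using assms(3) unfolding bipartite_matroid_def by fastforce
  qed
  then obtain i where i: "vec_nth (A e) i \<noteq> 0" by (auto simp: Finite_Cartesian_Product.vec_eq_iff)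
  define B\<^sub>0 where "B\<^sub>0 = (\<lambda>g. pivot A e i (A g))"
  have tu0: "totally_unimodular (E - {e}) B\<^sub>0"
    unfolding B\<^sub>0_def by (rule totally_unimodular_pivot[of E A, OF tu assms(4) i])
  have ind0: "indep_family B\<^sub>0 X \<longleftrightarrow> indep_family A (insert e X)" if "X \<subseteq> E - {e}" for X
    unfolding B\<^sub>0_def using that finE'
    by (intro indep_family_pivot[of X e A, OF _ _ i]) (auto intro: finite_subset)
  have "regular_representation (E - {e}) (contract_indep indep e) B\<^sub>0"
    unfolding regular_representation_def vector_matroid_indep_iff[OF finE'] cind
    using tu0 ind0 by blast
  moreover have "hstar (symmetric_edge_polytope E A) =
      (1 + fps_X) * hstar (symmetric_edge_polytope (E - {e}) B)"
    if B: "regular_representation (E - {e}) (contract_indep indep e) B" for B :: "'a \<Rightarrow> real ^ 'n"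
  proof -
    have tuB: "totally_unimodular (E - {e}) B" using B by (simp add: regular_representation_def)
    have indB: "indep_family B X \<longleftrightarrow> indep_family A (insert e X)" if "X \<subseteq> E - {e}" for X
      using B that cind[of X] vector_matroid_indep_iff[OF finE', of B X]
      by (simp add: regular_representation_def)
    have "indep_family B\<^sub>0 X \<longleftrightarrow> indep_family B X" if "X \<subseteq> E - {e}" for X
      using ind0[OF that] indB[OF that] by simp
    \<comment> \<open>The given \<open>B\<close> and the pivoted matrix represent the same matroid,
      so they have the same ball counts.\<close>
    then obtain \<sigma> :: "'a \<Rightarrow> real" where \<sigma>: "\<forall>g. \<sigma> g \<in> {1, -1}"
      "\<forall>z. lincomb B\<^sub>0 (E - {e}) z = 0 \<longleftrightarrow> lincomb B (E - {e}) (\<lambda>g. \<sigma> g * z g) = 0"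
      using unimodular_family_unique[OF finE' totally_unimodular_imp_unimodular_family[OF tu0 finE']
        totally_unimodular_imp_unimodular_family[OF tuB finE']] by blast
    define a where "a m = int (card (int_ball A E m))" for m
    define b where "b m = int (card (int_ball B (E - {e}) m))" for m
    have b0: "b m = int (card (int_ball B\<^sub>0 (E - {e}) m))" for m
      unfolding b_def using card_int_ball_eq_of_signing[OF finE', of \<sigma> B\<^sub>0 B m] \<sigma> by simp
    have "a (Suc n) = a n + b (Suc n) + b n" for n
    proof -
      have "even (\<Sum>g\<in>E. z g)" if "lincomb A E (\<lambda>g. real_of_int (z g)) = 0" for z :: "'a \<Rightarrow> int"
        by (rule even_sum_of_kernel[OF fin totally_unimodular_imp_unimodular_family[OF tu fin] ind assms(3) that])
      from card_int_ball_Suc[of E A, OF tu fin assms(4) i this] show ?thesis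
        unfolding a_def b0 B\<^sub>0_def by simp
    qed
    moreover have "a 0 = 1" "b 0 = 1" by (simp_all add: a_def b_def int_ball_0 fin finE')
    \<comment> \<open>The recursion compared coefficientwise; the values at 0 supply the constant
      term.\<close>
    ultimately have series: "(1 - fps_X) * Abs_fps a = (1 + fps_X) * Abs_fps b"
      by (intro fps_ext, rename_tac n, case_tac n) (simp_all add: algebra_simps)
    have dim: "dim (A ` E) = Suc (dim (B ` (E - {e})))"
      by (rule dim_contraction[OF fin assms(4) indB])
    define d where "d = dim (B ` (E - {e})) + 1"
    \<comment> \<open>Contraction lowers the dimension by one; the extra factor
      \<open>1 - fps_X\<close> is the one consumed by the identity of series.\<close>
    have "hstar (symmetric_edge_polytope E A) = Abs_fps a * (1 - fps_X) ^ Suc d"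
      using hstar_symmetric_edge_polytope[OF tu fin] unfolding a_def d_def dim by simp
    also have "\<dots> = (1 - fps_X) * Abs_fps a * (1 - fps_X) ^ d" by (simp only: power_Suc mult_ac)
    also have "\<dots> = (1 + fps_X) * (Abs_fps b * (1 - fps_X) ^ d)"
      unfolding series by (rule mult.assoc)
    also have "Abs_fps b * (1 - fps_X) ^ d = hstar (symmetric_edge_polytope (E - {e}) B)"
      using hstar_symmetric_edge_polytope[OF tuB finE'] unfolding b_def d_def by simp
    finally show ?thesis .
  qed
  ultimately show ?thesis by blast
qed

end
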